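(* Let $X$ be a compact space, let $V_n$ be an $n$-dimensional space ($n\geq2$) of bounded measurable functions $X\to\mathbb C$, and let $\mu^*$ be an optimal probability measure on $X$ for $V_n$ (in the sense defined in the context). Then Algorithm B (defined in the context), applied with $m=n$, the measure $\mu=\mu^*$, and inputs $\delta=\sqrt{1-1/n}$ and $\kappa=1$, almost surely provides $n$ points $x_1,\dots,x_n\in X$ for which, for every $f:X\to\mathbb C$, the interpolation $\tilde f^*=P_n^nf\in V_n$ of $f$ at $x_1,\dots,x_n$ satisfies $$\|f-\tilde f^*\|_{\mathcal L^\infty}\leq(1+2n\sqrt n)\min_{v\in V_n}\|f-v\|_{\mathcal L^\infty}.$$
   Context: Notation. $\|g\|_{\mathcal L^\infty}=\sup_{x\in X}|g(x)|$ is the strong (everywhere) supremum norm, possibly $+\infty$. $X$ carries its Borel $\sigma$-algebra and $\mathrm{Prob}(X)$ is the set of probability measures on it. $I$ is the $n\times n$ identity matrix and $\operatorname{Tr}$ is the trace; vectors $\varphi(x)\in\mathbb C^n$ are columns and $\varphi(x)^*$ is the conjugate transpose. Optimal measure (Kiefer–Wolfowitz). Let $\phi=(\phi_1,\dots,\phi_n)$ be a basis of $V_n$, and for $\mu\in\mathrm{Prob}(X)$ let $M(\mu)=\int_X\phi\phi^*\,d\mu$, an $n\times n$ matrix. An optimal measure is $$\mu^*\in\operatorname*{arg\,min}_{\mu\in\mathrm{Prob}(X)}\ \sup_{x\in X}\ \phi(x)^*M(\mu)^{-1}\phi(x)=\operatorname*{arg\,max}_{\mu\in\mathrm{Prob}(X)}\det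 M(\mu),$$ where the minimum is over measures $\mu$ with $M(\mu)$ non-singular. Let $\varphi=(\varphi_1,\dots,\varphi_n)$ be a basis of $V_n$ that is orthonormal in $L^2(X,\mu)$. Given points $x_1,\dots,x_n\in X$ that are unisolvent for $V_n$, $P_n^nf$ is the unique element of $V_n$ with $P_n^nf(x_i)=f(x_i)$ for $i=1,\dots,n$. Algorithm B (inputs: $\mu$, $\delta\in(0,1)$, $\kappa\in[0,1]$). Start with $A_0=0\in\mathbb R^{n\times n}$, $\ell_0=-n$. For $i=1,\dots,m$: let $Y_i=(A_{i-1}-\ell_{i-1}I)^{-1}$, $\ell_i=\ell_{i-1}+\delta$, $Z_i=(A_{i-1}-\ell_iI)^{-1}$, $W_i=\big(\operatorname{Tr}(Z_i)-\operatorname{Tr}(Y_i)\big)^{-1}Z_i^2-Z_i$, $w_i(x)=\varphi(x)^*W_i\varphi(x)$; let $R_i(x)=w_i(x)$ if $w_i(x)\geq\kappa\frac{1-\delta}{\delta}$ and $R_i(x)=0$ otherwise, and $\Gamma_i=\int_XR_i\,d\mu$; conditionally on $x_1,\dots,x_{i-1}$, draw $x_i$ from the probability measure $\frac{R_i(x)}{\Gamma_i}\,d\mu(x)$; let $s_i=1/R_i(x_i)=1/w_i(x_i)$ and $A_i=A_{i-1}+s_i\varphi(x_i)\varphi(x_i)^*$. Output: points $x_1,\dots,x_m$, weights $s_1,\dots,s_m$, matrix $A_m$. *)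

theory Defs
  imports "HOL-Probability.Probability" "HOL-Library.Function_Algebras"
begin

section \<open>Finite-dimensional spaces of complex-valued functions\<close>

definition fscale :: "complex \<Rightarrow> ('a \<Rightarrow> complex) \<Rightarrow> 'a \<Rightarrow> complex"
  where "fscale c f = (\<lambda>x. c * f x)"

global_interpretation cfun: vector_space fscale
  by unfold_locales (auto simp: fscale_def fun_eq_iff algebra_simps)

definition is_basis :: "('n::finite \<Rightarrow> 'a \<Rightarrow> complex) \<Rightarrow> ('a \<Rightarrow> complex) set \<Rightarrow> bool"
  where "is_basis \<phi> V \<longleftrightarrow> inj \<phi> \<and> cfun.independent (range \<phi>) \<and> cfun.span (range \<phi>) = V"

definition orthonormal_on :: "'a measure \<Rightarrow> ('n::finite \<Rightarrow> 'a \<Rightarrow> complex) \<Rightarrow> bool"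
  where "orthonormal_on \<mu> \<phi> \<longleftrightarrow>
    (\<forall>i j. (LINT x|\<mu>. \<phi> i x * cnj (\<phi> j x)) = (if i = j then 1 else 0))"

definition linf_norm :: "('a \<Rightarrow> complex) \<Rightarrow> ennreal"
  where "linf_norm f = (SUP x. ennreal (norm (f x)))"

text \<open>Points are numbered from 1 to \<open>n\<close>; the values of \<open>x\<close> at other indices are irrelevant.\<close>

definition unisolvent :: "('a \<Rightarrow> complex) set \<Rightarrow> nat \<Rightarrow> (nat \<Rightarrow> 'a) \<Rightarrow> bool"
  where "unisolvent V n x \<longleftrightarrow> (\<forall>y. \<exists>!v. v \<in> V \<and> (\<forall>i\<in>{1..n}. v (x i) = y i))"

definition interpolant ::
    "('a \<Rightarrow> complex) set \<Rightarrow> nat \<Rightarrow> (nat \<Rightarrow> 'a) \<Rightarrow> ('a \<Rightarrow> complex) \<Rightarrow> 'a \<Rightarrow> complex"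
  where "interpolant V n x f = (THE v. v \<in> V \<and> (\<forall>i\<in>{1..n}. v (x i) = f (x i)))"


section \<open>Optimal measures\<close>

definition vec_at :: "('n::finite \<Rightarrow> 'a \<Rightarrow> complex) \<Rightarrow> 'a \<Rightarrow> complex ^ 'n"
  where "vec_at \<phi> x = (\<chi> i. \<phi> i x)"

definition outer :: "complex ^ 'n \<Rightarrow> complex ^ 'n ^ 'n"
  where "outer v = (\<chi> i j. v $ i * cnj (v $ j))"

text \<open>The real part of \<open>v\<^sup>* B v\<close>. All matrices \<open>B\<close> for which this is used are Hermitian
  (as long as the inverses involved exist), so that \<open>v\<^sup>* B v\<close> is real.\<close>

definition hquad :: "complex ^ 'n ^ 'n \<Rightarrow> complex ^ 'n \<Rightarrow> real"
  where "hquad B v = Re (\<Sum>i\<in>UNIV. cnj (v $ i) * (B *v v) $ i)"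

definition moment_matrix :: "('n::finite \<Rightarrow> 'a \<Rightarrow> complex) \<Rightarrow> 'a measure \<Rightarrow> complex ^ 'n ^ 'n"
  where "moment_matrix \<phi> \<mu> = (LINT x|\<mu>. outer (vec_at \<phi> x))"

definition optimal_measure ::
    "('n::finite \<Rightarrow> 'a::topological_space \<Rightarrow> complex) \<Rightarrow> 'a measure \<Rightarrow> bool"
  where "optimal_measure \<phi> \<mu> \<longleftrightarrow>
    is_arg_min (\<lambda>\<nu>. SUP x. ereal (hquad (matrix_inv (moment_matrix \<phi> \<nu>)) (vec_at \<phi> x)))
      (\<lambda>\<nu>. \<nu> \<in> space (prob_algebra borel) \<and> invertible (moment_matrix \<phi> \<nu>)) \<mu>"


section \<open>The randomized point selection algorithm\<close>

definition shift_mat :: "complex ^ 'n ^ 'n \<Rightarrow> real \<Rightarrow> complex ^ 'n ^ 'n"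
  where "shift_mat A l = A - mat (complex_of_real l)"

text \<open>In the definitions below, \<open>A\<close> and \<open>l\<close> stand for \<open>A\<^sub>i\<^sub>-\<^sub>1\<close> and \<open>\<ell>\<^sub>i\<^sub>-\<^sub>1\<close>,
  and \<open>\<ell>\<^sub>i = l + \<delta>\<close>.\<close>

definition W_mat :: "real \<Rightarrow> complex ^ 'n ^ 'n \<Rightarrow> real \<Rightarrow> complex ^ 'n ^ 'n"
  where "W_mat \<delta> A l =
    (let Y = matrix_inv (shift_mat A l); Z = matrix_inv (shift_mat A (l + \<delta>))
     in mat (inverse (trace Z - trace Y)) ** (Z ** Z) - Z)"

definition R_fun ::
    "('n::finite \<Rightarrow> 'a \<Rightarrow> complex) \<Rightarrow> real \<Rightarrow> real \<Rightarrow> complex ^ 'n ^ 'n \<Rightarrow> real \<Rightarrow> 'a \<Rightarrow> real"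
  where "R_fun \<phi> \<delta> \<kappa> A l x =
    (let w = hquad (W_mat \<delta> A l) (vec_at \<phi> x) in if w \<ge> \<kappa> * ((1 - \<delta>) / \<delta>) then w else 0)"

primrec ell :: "nat \<Rightarrow> real \<Rightarrow> nat \<Rightarrow> real"
  where
    "ell n \<delta> 0 = - real n"
  | "ell n \<delta> (Suc i) = ell n \<delta> i + \<delta>"

primrec A_mat ::
    "('n::finite \<Rightarrow> 'a \<Rightarrow> complex) \<Rightarrow> real \<Rightarrow> real \<Rightarrow> (nat \<Rightarrow> 'a) \<Rightarrow> nat \<Rightarrow> complex ^ 'n ^ 'n"
  where
    "A_mat \<phi> \<delta> \<kappa> x 0 = 0"
  | "A_mat \<phi> \<delta> \<kappa> x (Suc i) =
      A_mat \<phi> \<delta> \<kappa> x i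
      + (1 / R_fun \<phi> \<delta> \<kappa> (A_mat \<phi> \<delta> \<kappa> x i) (ell CARD('n) \<delta> i) (x (Suc i)))
          *\<^sub>R outer (vec_at \<phi> (x (Suc i)))"

text \<open>The conditional law of the point \<open>x\<^sub>i\<^sub>+\<^sub>1\<close> given \<open>x\<^sub>1, \<dots>, x\<^sub>i\<close>. If the step cannot be
  performed (an inverse does not exist, or \<open>R\<close> cannot be normalised to a probability density;
  the Bochner integral of a non-integrable function is 0), the null measure is used.
  Hence the law of the output below is a probability measure
  if and only if the algorithm almost surely does not break down.\<close>

definition algB_step ::
    "('n::finite \<Rightarrow> 'a \<Rightarrow> complex) \<Rightarrow> 'a measure \<Rightarrow> real \<Rightarrow> real \<Rightarrow> nat \<Rightarrow> (nat \<Rightarrow> 'a) \<Rightarrow> 'a measure"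
  where "algB_step \<phi> \<mu> \<delta> \<kappa> i x =
    (let A = A_mat \<phi> \<delta> \<kappa> x i;
         l = ell CARD('n) \<delta> i;
         Y = matrix_inv (shift_mat A l);
         Z = matrix_inv (shift_mat A (l + \<delta>));
         R = R_fun \<phi> \<delta> \<kappa> A l;
         \<Gamma> = (LINT y|\<mu>. R y)
     in if invertible (shift_mat A l) \<and> invertible (shift_mat A (l + \<delta>))
           \<and> trace Z \<noteq> trace Y \<and> \<Gamma> > 0
        then density \<mu> (\<lambda>y. ennreal (R y / \<Gamma>))
        else null_measure \<mu>)"

text \<open>The joint law of the points \<open>x\<^sub>1, \<dots>, x\<^sub>m\<close>. The output weights and matrix are the functions
  \<open>1 / R_fun \<dots>\<close> and \<open>A_mat\<close> of these points. Only the \<open>\<sigma>\<close>-algebras of the product spaces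
  below matter, not the product measures on them.\<close>

primrec algB ::
    "('n::finite \<Rightarrow> 'a \<Rightarrow> complex) \<Rightarrow> 'a measure \<Rightarrow> real \<Rightarrow> real \<Rightarrow> nat \<Rightarrow> (nat \<Rightarrow> 'a) measure"
  where
    "algB \<phi> \<mu> \<delta> \<kappa> 0 = return (\<Pi>\<^sub>M i\<in>{1..0}. \<mu>) (\<lambda>i. undefined)"
  | "algB \<phi> \<mu> \<delta> \<kappa> (Suc m) =
      algB \<phi> \<mu> \<delta> \<kappa> m \<bind>
        (\<lambda>x. distr (algB_step \<phi> \<mu> \<delta> \<kappa> m x) (\<Pi>\<^sub>M i\<in>{1..Suc m}. \<mu>) (\<lambda>y. x(Suc m := y)))"

end

theory Submission
  imports Defs
begin

text \<open>The potential \<open>trace ((A\<^sub>i - \<ell>\<^sub>i I)\<^sup>-\<^sup>1)\<close> starts at 1. Since it never exceeds 1, the barrier can move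
  by \<open>\<delta> < 1\<close> without meeting the spectrum, and \<open>\<integral>w\<^sub>i d\<mu> = trace W\<^sub>i \<ge> (1 - \<delta>) / \<delta>\<close> shows that the step can be
  performed; the weight \<open>1 / w\<^sub>i(x\<^sub>i)\<close> then restores the potential exactly to 1. After \<open>n\<close> steps
  \<open>A\<^sub>n - \<ell>\<^sub>n I \<ge> I\<close>, so \<open>A\<^sub>n \<ge> (\<delta> / (1 + \<delta>)) I\<close>, while all weights are at most \<open>\<delta> / (1 - \<delta>)\<close>. This bounds
  the coefficients of an element of \<open>V\<close> by its values at the selected points. They are turned into a
  uniform bound by \<open>|\<phi>(x)|\<^sup>2 \<le> n\<close>, which for an optimal measure comes from comparing
  determinants of moment matrices of \<open>\<nu>\<close> and of mixtures of \<open>\<nu>\<close> with point masses.\<close>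

section \<open>Positive definite complex matrices\<close>

text \<open>Origin of the constants: with step size d the barrier ends at -n (1 - d), and the
  argument bounds the squared coefficient norm by (d / (1 - d)) / (1 - n (1 - d)) times the sum of
  the squared nodal values. This factor is smallest at d = sqrt (1 - 1/n), where n (1 - d) (1 + d) =
  1 and the factor is n (1 + d)^2 <= 4 n. Summing over n nodes and taking the root gives 2 n; the
  remaining sqrt n is the bound on |\<phi>(x)|. Randomness only serves to find points: every run
  whose draws all have positive density satisfies the estimates deterministically, and probability
  enters only to show that almost all runs are of this kind. The threshold for \<kappa> = 1 equals
  the guaranteed lower bound for the mean of the function w, so w cannot stay below it almost
  everywhere; the same threshold caps the weights. Eigenvalues never appear: positivity is handled
  by quadratic forms, congruences and traces.\<close>

definition cdot :: "complex ^ 'n \<Rightarrow> complex ^ 'n \<Rightarrow> complex"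
  where "cdot u v = (\<Sum>i\<in>UNIV. cnj (u $ i) * v $ i)"

definition adj :: "complex ^ 'n ^ 'm \<Rightarrow> complex ^ 'm ^ 'n"
  where "adj A = (\<chi> i j. cnj (A $ j $ i))"

definition pos_def :: "complex ^ 'n ^ 'n \<Rightarrow> bool"
  where "pos_def A \<longleftrightarrow> adj A = A \<and> (\<forall>v. v \<noteq> 0 \<longrightarrow> 0 < hquad A v)"

lemma hquad_cdot: "hquad B v = Re (cdot v (B *v v))"
  by (simp add: hquad_def cdot_def)

lemma cdot_simps:
  "cdot u (v + w) = cdot u v + cdot u w"
  "cdot u (v - w) = cdot u v - cdot u w"
  "cdot (u + v) w = cdot u w + cdot v w"
  "cdot (u - v) w = cdot u w - cdot v w"
  "cdot u (c *s v) = c * cdot u v"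
  "cdot (c *s u) v = cnj c * cdot u v"
  "cdot u (r *\<^sub>R v) = r *\<^sub>R cdot u v"
  "cdot (r *\<^sub>R u) v = r *\<^sub>R cdot u v"
  by (simp_all add: cdot_def algebra_simps sum.distrib sum_subtractf sum_distrib_left scaleR_sum_right)

lemma cnj_cdot: "cnj (cdot u v) = cdot v u"
  by (simp add: cdot_def mult.commute)

lemma cdot_self: "cdot u u = complex_of_real ((norm u)\<^sup>2)"
  by (simp add: cdot_def norm_vec_def L2_set_def sum_nonneg complex_norm_square mult.commute del: of_real_power)

lemma cdot_mult_adj: "cdot u (A *v v) = cdot (adj A *v u) v"
proof -
  have "cdot u (A *v v) = (\<Sum>i\<in>UNIV. \<Sum>j\<in>UNIV. cnj (u $ i) * A $ i $ j * v $ j)"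
    by (simp add: cdot_def matrix_vector_mult_def sum_distrib_left mult.assoc)
  also have "\<dots> = (\<Sum>j\<in>UNIV. \<Sum>i\<in>UNIV. cnj (u $ i) * A $ i $ j * v $ j)"
    by (rule sum.swap)
  also have "\<dots> = cdot (adj A *v u) v"
    by (simp add: cdot_def adj_def matrix_vector_mult_def sum_distrib_left mult_ac)
  finally show ?thesis .
qed

lemma adj_adj [simp]: "adj (adj A) = A"
  by (simp add: adj_def vec_eq_iff)

lemma adj_mult: "adj (A ** B) = adj B ** adj A"
  by (simp add: adj_def matrix_matrix_mult_def vec_eq_iff mult.commute)

lemma adj_add: "adj (A + B) = adj A + adj B"
  by (simp add: adj_def vec_eq_iff)

lemma adj_diff: "adj (A - B) = adj A - adj B"
  by (simp add: adj_def vec_eq_iff)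

lemma adj_scaleR: "adj (r *\<^sub>R A) = r *\<^sub>R adj A"
  by (simp add: adj_def vec_eq_iff)

lemma adj_mat: "adj (mat c) = mat (cnj c)"
  by (simp add: adj_def mat_def vec_eq_iff)

lemma adj_outer: "adj (outer v) = outer v"
  by (simp add: adj_def outer_def vec_eq_iff mult.commute)

lemma mat_mult_vec: "mat c *v (v :: complex ^ 'n) = c *s v"
  by (simp add: vec_eq_iff matrix_vector_mult_def mat_def if_distrib[of "\<lambda>a. a * _"]
      sum.delta cong: if_cong)

lemma scaleR_eq_mat: "r *\<^sub>R A = mat (complex_of_real r) ** A"
  by (simp add: vec_eq_iff matrix_matrix_mult_def mat_def if_distrib[of "\<lambda>a. a * _"]
      sum.delta scaleR_conv_of_real[where 'a=complex] cong: if_cong)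

lemma mat_mult_commute: "mat c ** (A :: complex ^ 'n ^ 'n) = A ** mat c"
  by (simp add: vec_eq_iff matrix_matrix_mult_def mat_def if_distrib[of "\<lambda>a. a * _"]
      if_distrib[of "\<lambda>a. _ * a"] sum.delta cong: if_cong)

lemma scaleR_mult_left: "(r *\<^sub>R A) ** B = r *\<^sub>R (A ** B :: complex ^ 'n ^ 'm)"
  by (simp add: vec_eq_iff matrix_matrix_mult_def scaleR_sum_right)

lemma scaleR_mult_right: "A ** (r *\<^sub>R B) = r *\<^sub>R (A ** B :: complex ^ 'n ^ 'm)"
  by (simp add: vec_eq_iff matrix_matrix_mult_def scaleR_sum_right)

lemma matrix_diff_ldistrib: "A ** (B - C) = A ** B - A ** (C :: complex ^ 'n ^ 'm)"
  by (simp add: vec_eq_iff matrix_matrix_mult_def sum_subtractf algebra_simps)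

lemma matrix_diff_rdistrib: "(B - C) ** A = B ** A - C ** (A :: complex ^ 'n ^ 'm)"
  by (simp add: vec_eq_iff matrix_matrix_mult_def sum_subtractf algebra_simps)

lemma matrix_add_rdistrib: "(B + C) ** A = B ** A + C ** (A :: complex ^ 'n ^ 'm)"
  by (simp add: vec_eq_iff matrix_matrix_mult_def sum.distrib algebra_simps)

lemma scaleR_mult_vec: "(r *\<^sub>R A) *v v = r *\<^sub>R (A *v v :: complex ^ 'n)"
  by (simp add: vec_eq_iff matrix_vector_mult_def scaleR_sum_right)

lemma trace_scaleR: "trace (r *\<^sub>R A :: complex ^ 'n ^ 'n) = r *\<^sub>R trace A"
  by (simp add: trace_def scaleR_sum_right)

lemma trace_mat: "trace (mat c :: complex ^ 'n ^ 'n) = of_nat CARD('n) * c"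
  by (simp add: trace_def mat_def)

lemma outer_mult_vec: "outer v *v w = cdot v w *s v"
  by (simp add: vec_eq_iff matrix_vector_mult_def outer_def cdot_def sum_distrib_left sum_distrib_right mult_ac)

lemma trace_mult_outer: "trace (P ** outer u) = cdot u (P *v u)"
  by (simp add: trace_def matrix_matrix_mult_def outer_def cdot_def matrix_vector_mult_def
      sum_distrib_left mult_ac)

lemma hquad_outer: "hquad (outer v) u = (cmod (cdot v u))\<^sup>2"
proof -
  have "cdot u (outer v *v u) = cdot v u * cnj (cdot v u)"
    by (simp add: outer_mult_vec cdot_simps cnj_cdot)
  then show ?thesis
    unfolding hquad_cdot complex_norm_square[symmetric] by simp
qed

lemma hquad_simps:
  "hquad (A + B) v = hquad A v + hquad B v"
  "hquad (A - B) v = hquad A v - hquad B v"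
  "hquad (r *\<^sub>R A) v = r * hquad A v"
  by (simp_all add: hquad_cdot cdot_simps matrix_vector_mult_add_rdistrib
      matrix_vector_mult_diff_rdistrib scaleR_mult_vec)

lemma hquad_mat: "hquad (mat (complex_of_real r)) v = r * (norm v)\<^sup>2"
  by (simp add: hquad_cdot mat_mult_vec cdot_simps cdot_self)

lemma hquad_congruence: "hquad (adj X ** A ** X) v = hquad A (X *v v)"
proof -
  have "(adj X ** A ** X) *v v = adj X *v (A *v (X *v v))"
    by (simp only: matrix_vector_mul_assoc[symmetric])
  then show ?thesis
    by (simp add: hquad_cdot cdot_mult_adj)
qed

lemma hquad_shift_mat: "hquad (shift_mat A l) v = hquad A v - l * (norm v)\<^sup>2"
  by (simp add: shift_mat_def hquad_simps hquad_mat)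

lemma trace_eq_hquad: "Re (trace A) = (\<Sum>i\<in>UNIV. hquad A (axis i 1))"
proof -
  have "cdot (axis i 1) (A *v axis i 1) = A $ i $ i" for i
    by (simp add: cdot_def axis_def matrix_vector_mult_def if_distrib[of cnj]
        if_distrib[of "\<lambda>a. a * _"] if_distrib[of "\<lambda>a. _ * a"] sum.delta cong: if_cong)
  then show ?thesis
    by (simp add: trace_def hquad_cdot)
qed

lemma trace_nonneg: "(\<And>v. 0 \<le> hquad A v) \<Longrightarrow> 0 \<le> Re (trace A)"
  by (simp add: trace_eq_hquad sum_nonneg)

lemma trace_hermitian: "adj A = A \<Longrightarrow> trace A = complex_of_real (Re (trace A))"
proof -
  assume "adj A = A"
  then have "cnj (trace A) = trace A"
    by (metis (no_types, lifting) adj_def cnj_sum sum.cong trace_def vec_lambda_beta)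
  then show ?thesis
    by (metis Reals_cnj_iff of_real_Re)
qed

text \<open>Takes the place of bounding the largest eigenvalue by the sum of all of them. What
  remains after compressing \<open>P\<close> to the orthogonal complement of \<open>u\<close> still
  has nonnegative trace, and the part removed is the form of \<open>P\<close> at \<open>u\<close>,
  up to normalisation.\<close>

lemma hquad_le_trace:
  assumes "\<And>v. 0 \<le> hquad P v"
  shows "hquad P u \<le> (norm u)\<^sup>2 * Re (trace P)"
proof (cases "u = 0")
  case True
  then show ?thesis by (simp add: hquad_cdot cdot_def)
next
  case False
  define r where "r = (norm u)\<^sup>2"
  have r: "r > 0" using False by (simp add: r_def)
  define N where "N = mat (complex_of_real r) - outer u"
  have adjN: "adj N = N"
    by (simp add: N_def adj_diff adj_mat adj_outer)
  have "(outer u ** outer u) $ i $ j = u $ i * cdot u u * cnj (u $ j)" for i j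
    by (simp add: matrix_matrix_mult_def outer_def cdot_def sum_distrib_left sum_distrib_right mult.assoc)
  then have oo: "outer u ** outer u = r *\<^sub>R outer u"
    by (simp add: vec_eq_iff outer_def cdot_self r_def scaleR_conv_of_real[where 'a=complex] mult_ac)
  have "N ** N = mat (complex_of_real r) ** N - outer u ** N"
    by (simp add: N_def matrix_diff_rdistrib)
  also have "mat (complex_of_real r) ** N = r *\<^sub>R N"
    by (rule scaleR_eq_mat[symmetric])
  also have "outer u ** N = r *\<^sub>R outer u - r *\<^sub>R outer u"
    by (simp only: N_def matrix_diff_ldistrib oo mat_mult_commute[symmetric] scaleR_eq_mat)
  finally have NN: "N ** N = r *\<^sub>R N"
    by simp
  \<comment> \<open>\<open>N / r\<close> is the orthogonal projection along \<open>u\<close>; compressing \<open>P\<close> by it leaves a nonnegative trace.\<close>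
  have "0 \<le> Re (trace (adj N ** P ** N))"
    by (intro trace_nonneg) (simp add: hquad_congruence assms)
  also have "trace (adj N ** P ** N) = trace (N ** N ** P)"
    unfolding adjN by (metis matrix_mul_assoc trace_mul_sym)
  also have "\<dots> = r *\<^sub>R trace (N ** P)"
    by (simp add: NN scaleR_mult_left trace_scaleR)
  also have "trace (N ** P) = r *\<^sub>R trace P - cdot u (P *v u)"
    unfolding N_def matrix_diff_rdistrib trace_sub trace_mul_sym[of "outer u" P] trace_mult_outer
    by (simp only: scaleR_eq_mat[symmetric] trace_scaleR)
  finally show ?thesis
    using r by (simp add: hquad_cdot r_def zero_le_mult_iff)
qed

section \<open>Inverses of positive definite matrices\<close>

lemma pos_defD:
  assumes "pos_def A"
  shows "adj A = A" "v \<noteq> 0 \<Longrightarrow> 0 < hquad A v" "0 \<le> hquad A v"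
  using assms unfolding pos_def_def by (auto, cases "v = 0") (auto simp: hquad_cdot cdot_def less_imp_le)

lemma matrix_inv_mult:
  assumes "invertible (A :: complex ^ 'n ^ 'n)"
  shows "A ** matrix_inv A = mat 1" "matrix_inv A ** A = mat 1"
  using someI_ex[OF assms[unfolded invertible_def]] unfolding matrix_inv_def by auto

lemma matrix_inv_eqI:
  assumes "A ** B = mat 1"
  shows "invertible (A :: complex ^ 'n ^ 'n)" "matrix_inv A = B"
proof -
  show inv: "invertible A"
    using assms invertible_right_inverse by blast
  show "matrix_inv A = B"
    by (metis assms inv matrix_inv_mult(2) matrix_mul_assoc matrix_mul_lid matrix_mul_rid)
qed

lemma pos_def_invertible:
  assumes "pos_def A"
  shows "invertible A"
proof -
  have "v = 0" if "A *v v = 0" for v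
    using pos_defD(2)[OF assms, of v] that by (auto simp: hquad_cdot cdot_def)
  then show ?thesis
    using invertible_left_inverse matrix_left_invertible_ker by blast
qed

text \<open>Since \<open>A\<close> is Hermitian, its inverse X satisfies X = (adj X) A X. It is thus
  a congruence of \<open>A\<close>, and its form at \<open>u\<close> is the form of \<open>A\<close>
  at X u.\<close>

lemma pos_def_inverse:
  assumes "pos_def A"
  shows "pos_def (matrix_inv A)" "hquad (matrix_inv A) u = hquad A (matrix_inv A *v u)"
proof -
  note inv = matrix_inv_mult[OF pos_def_invertible[OF assms]]
  have "adj (matrix_inv A) ** A = mat 1"
    using arg_cong[OF inv(1), of adj] pos_defD(1)[OF assms] by (simp add: adj_mult adj_mat)
  then have herm: "adj (matrix_inv A) = matrix_inv A"
    by (metis inv(1) matrix_mul_assoc matrix_mul_lid matrix_mul_rid)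
  then have "matrix_inv A = adj (matrix_inv A) ** A ** matrix_inv A"
    by (metis inv(2) matrix_mul_lid)
  then show *: "hquad (matrix_inv A) u = hquad A (matrix_inv A *v u)" for u
    by (metis hquad_congruence)
  have "matrix_inv A *v v \<noteq> 0" if "v \<noteq> 0" for v
    using that by (metis inv(1) matrix_vector_mul_assoc matrix_vector_mul_lid matrix_vector_mult_0_right)
  then show "pos_def (matrix_inv A)"
    unfolding pos_def_def using herm * pos_defD(2)[OF assms] by simp
qed

text \<open>Nonnegativity of the form of \<open>B\<close> at u - B^-1 u reads 0 <= hquad B u - 2
  |u|^2 + hquad (B^-1) u, and the last term is at most |u|^2 by \<open>hquad_le_trace\<close>. This
  is how a potential of at most 1 keeps the spectrum at distance at least 1 from the
  barrier.\<close>

lemma pos_def_ge_norm: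
  assumes "pos_def B" and "Re (trace (matrix_inv B)) \<le> 1"
  shows "(norm u)\<^sup>2 \<le> hquad B u"
proof -
  note inv = matrix_inv_mult[OF pos_def_invertible[OF assms(1)]]
  let ?w = "matrix_inv B *v u"
  have Bw: "B *v ?w = u"
    by (simp add: matrix_vector_mul_assoc inv)
  have "cdot ?w (B *v u) = cdot u u"
    unfolding cdot_mult_adj[of _ B] pos_defD(1)[OF assms(1)] Bw ..
  moreover have "hquad (matrix_inv B) u = Re (cdot ?w u)"
    unfolding pos_def_inverse(2)[OF assms(1)] unfolding hquad_cdot Bw ..
  moreover have "Re (cdot ?w u) = Re (cdot u ?w)"
    using arg_cong[OF cnj_cdot[of u ?w], of Re] by simp
  ultimately have "hquad B (u - ?w) = hquad B u - 2 * (norm u)\<^sup>2 + hquad (matrix_inv B) u"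
    by (simp add: hquad_cdot matrix_vector_mult_diff_distrib cdot_simps Bw cdot_self)
  moreover have "hquad (matrix_inv B) u \<le> (norm u)\<^sup>2 * Re (trace (matrix_inv B))"
    by (intro hquad_le_trace pos_defD(3)[OF pos_def_inverse(1)[OF assms(1)]])
  moreover have "\<dots> \<le> (norm u)\<^sup>2 * 1"
    by (intro mult_left_mono assms(2)) auto
  ultimately show ?thesis
    using pos_defD(3)[OF assms(1), of "u - ?w"] by simp
qed

section \<open>The barrier step\<close>

lemma trace_pos:
  assumes "\<And>v. v \<noteq> 0 \<Longrightarrow> 0 < hquad A v"
  shows "0 < Re (trace A)"
  unfolding trace_eq_hquad by (intro sum_pos assms) (auto simp: axis_eq_0_iff)

lemma hquad_mult_self:
  assumes "adj Z = Z"
  shows "hquad (Z ** Z) v = (norm (Z *v v))\<^sup>2"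
proof -
  have "hquad (adj Z ** mat 1 ** Z) v = (norm (Z *v v))\<^sup>2"
    unfolding hquad_congruence using hquad_mat[of 1] by simp
  then show ?thesis using assms by simp
qed

text \<open>The resolvent identity for two shifts of one matrix: write \<open>B\<close> as
  \<open>C\<close> plus a scalar inside Z B Y and Y B Z, then cancel the inverse pairs.\<close>

lemma resolvent_diff:
  fixes B C Y Z :: "complex ^ 'n ^ 'n"
  assumes "C = B - mat (complex_of_real d)"
    and "B ** Y = mat 1" "Y ** B = mat 1" "C ** Z = mat 1" "Z ** C = mat 1"
  shows "Z - Y = d *\<^sub>R (Z ** Y)" "Z - Y = d *\<^sub>R (Y ** Z)"
proof -
  have BC: "B = C + mat (complex_of_real d)"
    using assms(1) by simp
  have "Z ** B ** Y = Z ** (C + mat (complex_of_real d)) ** Y"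
    using BC by simp
  also have "\<dots> = Y + Z ** mat (complex_of_real d) ** Y"
    by (simp add: matrix_add_ldistrib matrix_add_rdistrib assms(2-5))
  also have "Z ** mat (complex_of_real d) ** Y = d *\<^sub>R (Z ** Y)"
    by (simp add: mat_mult_commute[symmetric] scaleR_eq_mat matrix_mul_assoc)
  finally have "Z = Y + d *\<^sub>R (Z ** Y)"
    by (simp add: matrix_mul_assoc[symmetric] assms(2-5))
  then show "Z - Y = d *\<^sub>R (Z ** Y)"
    by (metis add_diff_cancel_left')
  have "Y ** B ** Z = Y ** (C + mat (complex_of_real d)) ** Z"
    using BC by simp
  also have "\<dots> = Y ** C ** Z + Y ** mat (complex_of_real d) ** Z"
    by (simp add: matrix_add_ldistrib matrix_add_rdistrib)
  also have "Y ** C ** Z = Y"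
    by (simp add: matrix_mul_assoc[symmetric] assms(2-5))
  also have "Y ** mat (complex_of_real d) ** Z = d *\<^sub>R (Y ** Z)"
    by (simp add: mat_mult_commute[symmetric] scaleR_eq_mat matrix_mul_assoc)
  finally have "Z = Y + d *\<^sub>R (Y ** Z)"
    by (simp add: assms(2-5))
  then show "Z - Y = d *\<^sub>R (Y ** Z)"
    by (metis add_diff_cancel_left')
qed

section \<open>One move of the barrier at potential at most 1\<close>

context
  fixes A Y Z :: "complex ^ 'n ^ 'n" and l \<delta> :: real
  assumes pd: "pos_def (shift_mat A l)"
    and Y_def: "Y = matrix_inv (shift_mat A l)"
    and Z_def: "Z = matrix_inv (shift_mat A (l + \<delta>))"
    and tr: "Re (trace Y) \<le> 1"
    and \<delta>: "0 < \<delta>" "\<delta> < 1"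
begin

lemma shift_mat_add: "shift_mat A (l + \<delta>) = shift_mat A l - mat (complex_of_real \<delta>)"
  by (simp add: shift_mat_def vec_eq_iff mat_def)

lemma pos_def_shift_next: "pos_def (shift_mat A (l + \<delta>))"
  unfolding pos_def_def
proof (intro conjI allI impI)
  show "adj (shift_mat A (l + \<delta>)) = shift_mat A (l + \<delta>)"
    by (simp add: shift_mat_add adj_diff adj_mat pos_defD(1)[OF pd])
  fix v :: "complex ^ 'n" assume "v \<noteq> 0"
  then have "0 < (1 - \<delta>) * (norm v)\<^sup>2"
    using \<delta> by simp
  moreover have "(norm v)\<^sup>2 \<le> hquad (shift_mat A l) v"
    by (rule pos_def_ge_norm[OF pd tr[unfolded Y_def]])
  ultimately show "0 < hquad (shift_mat A (l + \<delta>)) v"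
    unfolding shift_mat_add hquad_simps hquad_mat by (simp add: algebra_simps)
qed

lemma pos_def_YZ: "pos_def Y" "pos_def Z"
  unfolding Y_def Z_def by (intro pos_def_inverse pd pos_def_shift_next)+

lemma resolvent_shift: "Z - Y = \<delta> *\<^sub>R (Z ** Y)" "Z - Y = \<delta> *\<^sub>R (Y ** Z)"
  unfolding Y_def Z_def
  by (rule resolvent_diff[OF shift_mat_add]; intro matrix_inv_mult pos_def_invertible pd pos_def_shift_next)+

text \<open>Substituting the resolvent identity for \<open>Z\<close> turns Z Y into Y Y + \<delta> Y
  Z Y, a strictly positive square plus a congruence of \<open>Z\<close>. Hence the potential
  strictly increases when the barrier moves, and the denominator in \<open>W_mat\<close> is not
  0.\<close>

lemma trace_ZY:
  "0 < Re (trace (Z ** Y))" "Re (trace Z) - Re (trace Y) = \<delta> * Re (trace (Z ** Y))"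
proof -
  show "Re (trace Z) - Re (trace Y) = \<delta> * Re (trace (Z ** Y))"
    using arg_cong[OF resolvent_shift(1), of "\<lambda>M. Re (trace M)"] by (simp add: trace_sub trace_scaleR)
  have "Z = Y + \<delta> *\<^sub>R (Y ** Z)"
    using resolvent_shift(2) by (simp add: algebra_simps)
  then have "Z ** Y = (Y + \<delta> *\<^sub>R (Y ** Z)) ** Y"
    by (rule arg_cong)
  also have "\<dots> = Y ** Y + \<delta> *\<^sub>R (Y ** Z ** Y)"
    by (simp add: matrix_add_rdistrib scaleR_mult_left)
  finally have *: "hquad (Z ** Y) v = (norm (Y *v v))\<^sup>2 + \<delta> * hquad Z (Y *v v)" for v
    using hquad_congruence[of Y Z v]
    by (simp add: hquad_simps hquad_mult_self pos_defD(1)[OF pos_def_YZ(1)])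
  have "0 < hquad (Z ** Y) v" if "v \<noteq> 0" for v
  proof -
    have "Y *v v \<noteq> 0"
      using pos_defD(2)[OF pos_def_YZ(1) that] by (auto simp: hquad_cdot cdot_def)
    then show ?thesis
      unfolding * using \<delta>(1) pos_defD(3)[OF pos_def_YZ(2), of "Y *v v"]
      by (intro add_pos_nonneg) auto
  qed
  then show "0 < Re (trace (Z ** Y))"
    by (rule trace_pos)
qed

lemma trace_diff_pos: "0 < Re (trace Z) - Re (trace Y)"
  using trace_ZY \<delta>(1) by simp

lemma W_mat_eq:
  "W_mat \<delta> A l = (1 / (Re (trace Z) - Re (trace Y))) *\<^sub>R (Z ** Z) - Z"
proof -
  have "trace Z - trace Y = complex_of_real (Re (trace Z) - Re (trace Y))"
    using trace_hermitian pos_def_YZ[THEN pos_defD(1)] by (metis of_real_diff)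
  then show ?thesis
    unfolding W_mat_def Let_def Y_def[symmetric] Z_def[symmetric] scaleR_eq_mat
    by (simp add: inverse_eq_divide)
qed

text \<open>In terms of \<open>y\<close>, \<open>S\<close> and \<open>T\<close>, the resolvent
  identity gives trace Z - trace Y = \<delta> S and trace (Z Z) = S + \<delta> T, so the trace of W
  is 1/\<delta> + T/S - y - \<delta> S. Cauchy-Schwarz with y <= 1 makes T/S >= S >= \<delta> S, and
  1/\<delta> - y >= 1/\<delta> - 1 is left.\<close>

lemma trace_W_mat_ge: "(1 - \<delta>) / \<delta> \<le> Re (trace (W_mat \<delta> A l))"
proof -
  define y S T where "y = Re (trace Y)" and "S = Re (trace (Z ** Y))" and "T = Re (trace (Z ** Y ** Z))"
  note herm = pos_def_YZ[THEN pos_defD(1)]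
  have S: "S > 0" and z: "Re (trace Z) = y + \<delta> * S"
    using trace_ZY by (simp_all add: S_def y_def)
  have y: "0 < y" "y \<le> 1"
    using tr pos_defD(2)[OF pos_def_YZ(1)] by (auto simp: y_def intro: trace_pos)
  \<comment> \<open>Cauchy-Schwarz for the form \<open>(P, Q) \<mapsto> trace (P\<^sup>* Y Q)\<close>, applied to \<open>Z\<close> and the identity.\<close>
  have "S\<^sup>2 \<le> T * y"
  proof -
    \<comment> \<open>Minimiser of T - 2 t S + t^2 y, which is the trace of N Y N.\<close>
    define t where "t = S / y"
    define N where "N = Z - mat (complex_of_real t)"
    have "adj N = N"
      by (simp add: N_def adj_diff adj_mat herm)
    then have "hquad (N ** Y ** N) v = hquad Y (N *v v)" for v
      using hquad_congruence[of N Y v] by simp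
    then have "0 \<le> Re (trace (N ** Y ** N))"
      by (intro trace_nonneg) (simp add: pos_defD(3)[OF pos_def_YZ(1)])
    also have "N ** Y = Z ** Y - t *\<^sub>R Y"
      unfolding N_def matrix_diff_rdistrib scaleR_eq_mat ..
    also have "(Z ** Y - t *\<^sub>R Y) ** N = Z ** Y ** Z - t *\<^sub>R (Z ** Y) - t *\<^sub>R (Y ** Z) + t *\<^sub>R t *\<^sub>R Y"
      by (simp add: N_def matrix_diff_rdistrib matrix_diff_ldistrib scaleR_mult_left
          mat_mult_commute[symmetric] scaleR_eq_mat[symmetric] scaleR_diff_right)
    also have "Re (trace \<dots>) = T - t * S - t * S + t * (t * y)"
      by (simp add: trace_add trace_sub trace_scaleR T_def S_def y_def trace_mul_sym[of Y Z])
    also have "\<dots> = T - S\<^sup>2 / y"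
      using y by (simp add: t_def field_simps power2_eq_square)
    finally show ?thesis
      using y by (simp add: field_simps)
  qed
  \<comment> \<open>Monotonicity needs T >= 0, which follows from 0 <= S^2 <= T y and y > 0.\<close>
  moreover have "\<dots> \<le> T * 1"
    using calculation y S
    by (intro mult_left_mono)
       (auto intro: ccontr simp: zero_le_mult_iff dest: order_trans[OF zero_le_power2])
  ultimately have "S \<le> T / S"
    using S by (simp add: field_simps power2_eq_square)
  have "Z = Y + \<delta> *\<^sub>R (Z ** Y)"
    using resolvent_shift(1) by (simp add: algebra_simps)
  then have "Z ** Z = Z ** (Y + \<delta> *\<^sub>R (Z ** Y))"
    by (rule arg_cong)
  also have "\<dots> = Z ** Y + \<delta> *\<^sub>R (Z ** (Z ** Y))"
    by (simp add: matrix_add_ldistrib scaleR_mult_right)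
  finally have "Re (trace (Z ** Z)) = S + \<delta> * Re (trace (Z ** (Z ** Y)))"
    by (simp add: trace_add trace_scaleR S_def)
  also have "trace (Z ** (Z ** Y)) = trace (Z ** Y ** Z)"
    by (rule trace_mul_sym)
  finally have "Re (trace (W_mat \<delta> A l)) = (S + \<delta> * T) / (\<delta> * S) - (y + \<delta> * S)"
    unfolding W_mat_eq by (simp add: trace_sub trace_scaleR T_def[symmetric] z y_def[symmetric])
  also have "(S + \<delta> * T) / (\<delta> * S) = 1 / \<delta> + T / S"
    using S \<delta> by (simp add: field_simps)
  finally have "Re (trace (W_mat \<delta> A l)) = 1 / \<delta> + T / S - (y + \<delta> * S)" .
  moreover have "\<delta> * S \<le> S"
    using S \<delta> by simp
  moreover have "(1 - \<delta>) / \<delta> = 1 / \<delta> - 1"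
    using \<delta> by (simp add: field_simps)
  ultimately show ?thesis
    using \<open>S \<le> T / S\<close> y by linarith
qed

end

text \<open>Sherman-Morrison: the inverse is Z - c Z (outer v) Z with c = s / (1 + s q), because
  (outer v) Z (outer v) collapses to q times \<open>outer v\<close>. The trace of the correction
  term is c |Z v|^2.\<close>

lemma rank_one_update:
  assumes pd: "pos_def C" and "0 \<le> s"
  defines "Z \<equiv> matrix_inv C"
  shows "pos_def (C + s *\<^sub>R outer v)"
    and "Re (trace (matrix_inv (C + s *\<^sub>R outer v))) =
      Re (trace Z) - s / (1 + s * hquad Z v) * (norm (Z *v v))\<^sup>2"
proof -
  define q where "q = hquad Z v"
  define c where "c = s / (1 + s * q)"
  have pdZ: "pos_def Z"
    unfolding Z_def by (rule pos_def_inverse(1)[OF pd])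
  have CZ: "C ** Z = mat 1"
    unfolding Z_def by (intro matrix_inv_mult pos_def_invertible pd)
  have "q \<ge> 0"
    unfolding q_def by (rule pos_defD(3)[OF pdZ])
  then have c: "s = c * (1 + s * q)"
    using \<open>0 \<le> s\<close> by (simp add: c_def add_nonneg_eq_0_iff)
  show "pos_def (C + s *\<^sub>R outer v)"
    unfolding pos_def_def
    using pos_defD[OF pd] \<open>0 \<le> s\<close>
    by (auto simp: adj_add adj_scaleR adj_outer hquad_simps hquad_outer intro!: add_pos_nonneg)
  have "cdot v (Z *v v) = cnj (cdot v (Z *v v))"
    unfolding cnj_cdot using cdot_mult_adj[of v Z v] pos_defD(1)[OF pdZ] by simp
  then have q: "cdot v (Z *v v) = complex_of_real q"
    unfolding q_def hquad_cdot by (metis Reals_cnj_iff of_real_Re)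
  have "outer v ** Z ** outer v = q *\<^sub>R outer v"
  proof (rule matrix_eq[THEN iffD2], intro allI)
    fix u
    have "(outer v ** Z ** outer v) *v u = outer v *v (Z *v (outer v *v u))"
      by (simp only: matrix_vector_mul_assoc matrix_mul_assoc)
    also have "\<dots> = cdot v u *s (complex_of_real q *s v)"
      by (simp only: outer_mult_vec vector_scalar_commute q)
    finally show "(outer v ** Z ** outer v) *v u = (q *\<^sub>R outer v) *v u"
      by (simp add: scaleR_mult_vec outer_mult_vec vec_eq_iff scaleR_conv_of_real[where 'a=complex])
  qed
  then have oZoZ: "outer v ** (Z ** outer v ** Z) = q *\<^sub>R (outer v ** Z)"
    by (metis matrix_mul_assoc scaleR_mult_left)
  have CZoZ: "C ** (Z ** outer v ** Z) = outer v ** Z"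
    by (metis CZ matrix_mul_assoc matrix_mul_lid)
  have "(C + s *\<^sub>R outer v) ** (Z - c *\<^sub>R (Z ** outer v ** Z))
    = mat 1 - c *\<^sub>R (outer v ** Z) + (s *\<^sub>R (outer v ** Z) - (s * c * q) *\<^sub>R (outer v ** Z))"
    by (simp only: matrix_add_rdistrib matrix_diff_ldistrib scaleR_mult_left scaleR_mult_right
        CZ CZoZ oZoZ scaleR_scaleR mult_ac, simp add: algebra_simps)
  also have "\<dots> = mat 1 + (s - c * (1 + s * q)) *\<^sub>R (outer v ** Z)"
    by (simp add: algebra_simps)
  also have "\<dots> = mat 1"
    using c by simp
  finally have inv: "matrix_inv (C + s *\<^sub>R outer v) = Z - c *\<^sub>R (Z ** outer v ** Z)"
    by (rule matrix_inv_eqI)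
  have "trace (Z ** outer v ** Z) = trace (Z ** Z ** outer v)"
    by (metis matrix_mul_assoc trace_mul_sym)
  also have "\<dots> = cdot v ((Z ** Z) *v v)"
    by (rule trace_mult_outer)
  finally have "Re (trace (Z ** outer v ** Z)) = (norm (Z *v v))\<^sup>2"
    using hquad_mult_self[OF pos_defD(1)[OF pdZ]] by (simp add: hquad_cdot)
  then show "Re (trace (matrix_inv (C + s *\<^sub>R outer v))) =
      Re (trace Z) - s / (1 + s * hquad Z v) * (norm (Z *v v))\<^sup>2"
    by (simp add: inv trace_sub trace_scaleR c_def q_def)
qed

text \<open>The weight \<open>1 / w\<close> is chosen so that the update exactly undoes the increase of the
  potential caused by moving the barrier.\<close>

lemma potential_step:
  assumes pd: "pos_def (shift_mat A l)" and tr: "Re (trace (matrix_inv (shift_mat A l))) \<le> 1"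
    and \<delta>: "0 < \<delta>" "\<delta> < 1"
    and w: "w = hquad (W_mat \<delta> A l) v" "0 < w"
  shows "pos_def (shift_mat (A + (1 / w) *\<^sub>R outer v) (l + \<delta>))"
    and "Re (trace (matrix_inv (shift_mat (A + (1 / w) *\<^sub>R outer v) (l + \<delta>)))) =
      Re (trace (matrix_inv (shift_mat A l)))"
proof -
  define Y Z where "Y = matrix_inv (shift_mat A l)" and "Z = matrix_inv (shift_mat A (l + \<delta>))"
  note * = pd Y_def Z_def tr[folded Y_def] \<delta>
  define D q where "D = Re (trace Z) - Re (trace Y)" and "q = hquad Z v"
  have D: "D > 0"
    unfolding D_def by (rule trace_diff_pos[OF *])
  have q: "q \<ge> 0"
    unfolding q_def by (rule pos_defD(3)[OF pos_def_YZ(2)[OF *]])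
  have "w = (norm (Z *v v))\<^sup>2 / D - q"
    unfolding w(1) W_mat_eq[OF *]
    by (simp add: hquad_simps hquad_mult_self[OF pos_defD(1)[OF pos_def_YZ(2)[OF *]]] D_def q_def)
  then have Zv: "(norm (Z *v v))\<^sup>2 = D * (w + q)"
    using D by (simp add: field_simps)
  have shift: "shift_mat (A + (1 / w) *\<^sub>R outer v) (l + \<delta>) = shift_mat A (l + \<delta>) + (1 / w) *\<^sub>R outer v"
    by (simp add: shift_mat_def)
  note upd = rank_one_update[OF pos_def_shift_next[OF *], of "1 / w" v, folded Z_def]
  show "pos_def (shift_mat (A + (1 / w) *\<^sub>R outer v) (l + \<delta>))"
    unfolding shift using upd(1) w by simp
  \<comment> \<open>The drop of the trace in the rank-one update. The definition of w, solved for |Z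
    v|^2 in \<open>Zv\<close>, makes it equal to \<open>D\<close>, the amount that the move of the
    barrier had added.\<close>
  have "1 / w / (1 + 1 / w * q) * (D * (w + q)) = D"
    using w(2) q by (simp add: field_simps add_nonneg_eq_0_iff)
  then show "Re (trace (matrix_inv (shift_mat (A + (1 / w) *\<^sub>R outer v) (l + \<delta>)))) =
      Re (trace (matrix_inv (shift_mat A l)))"
    unfolding shift using upd(2) w Zv by (simp add: q_def D_def Y_def)
qed

section \<open>The Kiefer-Wolfowitz bound\<close>

lemma mat_1_row: "mat 1 = (\<chi> i. axis i 1)"
  by (simp add: vec_eq_iff mat_def axis_def)

lemma det_axis_replace_row:
  fixes v :: "'a :: field ^ 'n"
  shows "det (\<chi> i. if i = k then v else axis i 1) = v $ k"
proof -
  have row: "row i (mat 1 :: 'a ^ 'n ^ 'n) = axis i 1" for i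
    by (simp add: vec_eq_iff mat_def axis_def row_def)
  have "(\<Sum>i\<in>UNIV. v $ i *s row i (mat 1)) = v"
    unfolding row by (rule basis_expansion)
  then show ?thesis
    using cramer_lemma_transpose[of k v "mat 1"] unfolding row by (simp cong: if_cong)
qed

text \<open>Row \<open>k\<close> is \<open>v\<close> itself, so multiples of \<open>v\<close> may be
  removed from the other rows one at a time: by linearity in row \<open>j\<close> the extra term has
  two equal rows.\<close>

lemma det_axis_add_multiples_row:
  fixes v :: "'a :: field ^ 'n"
  assumes "finite S" "k \<notin> S"
  shows "det (\<chi> i. if i = k then v else if i \<in> S then axis i 1 + c i *s v else axis i 1) = v $ k"
  using assms
proof (induction S rule: finite_induct)
  case empty
  then show ?case by (simp add: det_axis_replace_row cong: if_cong)
next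
  case (insert j S)
  let ?r = "\<lambda>i. if i = k then v else if i \<in> S then axis i 1 + c i *s v else axis i 1"
  have "det (\<chi> i. if i = j then axis i 1 + c i *s v else ?r i)
    = det (\<chi> i. if i = j then axis i 1 else ?r i) + c j * det (\<chi> i. if i = j then v else ?r i)"
    by (subst det_row_add) (simp add: det_row_mul[symmetric] cong: if_cong)
  also have "(\<chi> i. if i = j then axis i 1 else ?r i) = (\<chi> i. ?r i)"
    using insert by (auto simp: vec_eq_iff)
  also have "det (\<chi> i. if i = j then v else ?r i) = 0"
    using insert by (intro det_identical_rows[of j k]) (auto simp: row_def)
  also have "(\<chi> i. if i = j then axis i 1 + c i *s v else ?r i)
    = (\<chi> i. if i = k then v else if i \<in> insert j S then axis i 1 + c i *s v else axis i 1)"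
    using insert by (auto simp: vec_eq_iff)
  finally show ?case
    using insert by simp
qed

text \<open>The matrix determinant lemma for the identity plus a rank-one matrix. The perturbation
  is added row by row; splitting row \<open>k\<close> contributes \<open>c k\<close> times a
  determinant with \<open>v\<close> in that row.\<close>

lemma det_axis_add_multiples:
  fixes v :: "'a :: field ^ 'n"
  assumes "finite S"
  shows "det (\<chi> i. if i \<in> S then axis i 1 + c i *s v else axis i 1) = 1 + (\<Sum>i\<in>S. c i * v $ i)"
  using assms
proof (induction S rule: finite_induct)
  case empty
  then show ?case by (simp add: mat_1_row[symmetric] cong: if_cong)
next
  case (insert k S)
  let ?r = "\<lambda>i. if i \<in> S then axis i 1 + c i *s v else axis i 1"
  have "det (\<chi> i. if i = k then axis i 1 + c i *s v else ?r i)
    = det (\<chi> i. if i = k then axis i 1 else ?r i) + c k * det (\<chi> i. if i = k then v else ?r i)"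
    by (subst det_row_add) (simp add: det_row_mul[symmetric] cong: if_cong)
  also have "(\<chi> i. if i = k then axis i 1 else ?r i) = (\<chi> i. ?r i)"
    using insert by (auto simp: vec_eq_iff)
  also have "det (\<chi> i. if i = k then v else ?r i) = v $ k"
    by (intro det_axis_add_multiples_row insert)
  also have "(\<chi> i. if i = k then axis i 1 + c i *s v else ?r i)
    = (\<chi> i. if i \<in> insert k S then axis i 1 + c i *s v else axis i 1)"
    using insert by (auto simp: vec_eq_iff)
  finally show ?case
    using insert by simp
qed

lemma det_mat: "det (mat c :: 'a :: comm_ring_1 ^ 'n ^ 'n) = c ^ CARD('n)"
  by (subst det_diagonal) (auto simp: mat_def)

text \<open>Factor the matrix as (1 - t) M N with N = I + (t / (1 - t)) M^-1 (outer v). The rows of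
  \<open>N\<close> are unit vectors plus multiples of the conjugate of \<open>v\<close>, as in
  \<open>det_axis_add_multiples\<close>.\<close>

lemma det_convex_outer:
  fixes M :: "complex ^ 'n ^ 'n"
  assumes "invertible M" "t \<noteq> 1"
  shows "det ((1 - t) *\<^sub>R M + t *\<^sub>R outer v) =
    (1 - t) ^ CARD('n) * (det M * (1 + t / (1 - t) * cdot v (matrix_inv M *v v)))"
proof -
  define u where "u = matrix_inv M *v v"
  define N :: "complex ^ 'n ^ 'n"
    where "N = (\<chi> i. axis i 1 + (complex_of_real (t / (1 - t)) * u $ i) *s (\<chi> j. cnj (v $ j)))"
  have "N = mat 1 + (t / (1 - t)) *\<^sub>R (matrix_inv M ** outer v)"
    by (simp add: N_def u_def vec_eq_iff mat_def axis_def matrix_matrix_mult_def matrix_vector_mult_def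
        outer_def sum_distrib_left sum_distrib_right sum_divide_distrib scaleR_conv_of_real[where 'a=complex] mult_ac)
  then have "M ** N = M + (t / (1 - t)) *\<^sub>R (M ** matrix_inv M ** outer v)"
    by (simp add: matrix_add_ldistrib scaleR_mult_right matrix_mul_assoc)
  then have "(1 - t) *\<^sub>R M + t *\<^sub>R outer v = mat (complex_of_real (1 - t)) ** (M ** N)"
    using assms(2) by (simp add: matrix_inv_mult(1)[OF assms(1)] scaleR_eq_mat[symmetric] scaleR_add_right del: of_real_diff)
  moreover have "det N = 1 + (t / (1 - t)) * cdot v u"
    using det_axis_add_multiples[of UNIV "\<lambda>i. complex_of_real (t / (1 - t)) * u $ i" "\<chi> j. cnj (v $ j)"]
    by (simp add: N_def cdot_def sum_distrib_left mult_ac)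
  ultimately show ?thesis
    by (simp add: det_mul det_mat u_def)
qed

text \<open>A crude bound on the Leibniz sum. It serves to bound the determinants of moment
  matrices, so that their supremum is finite.\<close>

lemma norm_det_le:
  fixes A :: "complex ^ 'n ^ 'n"
  assumes "\<And>i j. cmod (A $ i $ j) \<le> B"
  shows "cmod (det A) \<le> real (card {p. p permutes (UNIV :: 'n set)}) * B ^ CARD('n)"
proof -
  have "cmod (det A) \<le> (\<Sum>p\<in>{p. p permutes (UNIV :: 'n set)}. B ^ CARD('n))"
    unfolding det_def
  proof (rule order_trans[OF norm_sum], rule sum_mono)
    fix p :: "'n \<Rightarrow> 'n"
    have "cmod (of_int (sign p)) = 1"
      by (simp add: sign_def)
    moreover have "(\<Prod>i\<in>UNIV. cmod (A $ i $ p i)) \<le> (\<Prod>i\<in>(UNIV :: 'n set). B)"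
      by (intro prod_mono) (auto intro: assms)
    ultimately show "cmod (of_int (sign p) * (\<Prod>i\<in>UNIV. A $ i $ p i)) \<le> B ^ CARD('n)"
      by (simp add: norm_mult prod_norm[symmetric])
  qed
  then show ?thesis by simp
qed

lemma borel_measurable_vec:
  fixes f :: "'a \<Rightarrow> 'b :: euclidean_space ^ 'n"
  assumes "\<And>i. (\<lambda>x. f x $ i) \<in> borel_measurable M"
  shows "f \<in> borel_measurable M"
proof (rule borel_measurable_euclidean_space[THEN iffD2], intro ballI)
  fix b :: "'b ^ 'n" assume "b \<in> Basis"
  then obtain i u where "b = axis i u"
    by (auto simp: Basis_vec_def)
  then have "(\<lambda>x. f x \<bullet> b) = (\<lambda>x. f x $ i \<bullet> u)"
    by (simp add: inner_axis)
  then show "(\<lambda>x. f x \<bullet> b) \<in> borel_measurable M"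
    using assms by simp
qed

section \<open>Moment matrices of bounded families\<close>

locale bounded_family =
  fixes \<phi> :: "'n::finite \<Rightarrow> 'a::topological_space \<Rightarrow> complex" and K :: real
  assumes meas: "\<And>i. \<phi> i \<in> borel_measurable borel"
    and bounded: "\<And>i x. cmod (\<phi> i x) \<le> K"
begin

lemma measurable_entry: "(\<lambda>x. \<phi> i x * cnj (\<phi> j x)) \<in> borel_measurable borel"
  by (intro borel_measurable_times meas borel_measurable_continuous_onI[THEN measurable_compose_rev, OF _ meas])
     (auto intro!: continuous_intros)

lemma cmod_entry: "cmod (\<phi> i x * cnj (\<phi> j x)) \<le> K * K"
  unfolding norm_mult complex_mod_cnj
  by (intro mult_mono bounded) (auto intro: order_trans[OF norm_ge_zero bounded])

lemma integrable_entry: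
  assumes "\<nu> \<in> space (prob_algebra borel)"
  shows "integrable \<nu> (\<lambda>x. \<phi> i x * cnj (\<phi> j x))"
proof -
  interpret prob_space \<nu> using assms by (simp add: space_prob_algebra)
  have sets: "sets \<nu> = sets borel" using assms by (simp add: space_prob_algebra)
  show ?thesis
    by (rule integrable_const_bound[of _ "K * K"])
       (auto simp: cmod_entry measurable_cong_sets[OF sets refl] measurable_entry simp del: norm_mult intro!: AE_I2)
qed

lemma integrable_outer:
  assumes "\<nu> \<in> space (prob_algebra borel)"
  shows "integrable \<nu> (\<lambda>x. outer (vec_at \<phi> x))"
proof -
  interpret prob_space \<nu> using assms by (simp add: space_prob_algebra)
  have sets: "sets \<nu> = sets borel" using assms by (simp add: space_prob_algebra)
  have "norm (outer (vec_at \<phi> x)) \<le> (\<Sum>i\<in>(UNIV :: 'n set). \<Sum>j\<in>(UNIV :: 'n set). K * K)" for x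
    unfolding norm_vec_def outer_def vec_at_def
    by (intro order_trans[OF L2_set_le_sum] sum_mono) (auto simp: cmod_entry simp del: norm_mult)
  moreover have "(\<lambda>x. outer (vec_at \<phi> x)) \<in> borel_measurable \<nu>"
    by (intro borel_measurable_vec)
       (simp add: outer_def vec_at_def measurable_cong_sets[OF sets refl] measurable_entry)
  ultimately show ?thesis
    by (intro integrable_const_bound[of _ "\<Sum>i\<in>(UNIV :: 'n set). \<Sum>j\<in>(UNIV :: 'n set). K * K"] AE_I2)
qed

lemma moment_matrix_nth:
  assumes "\<nu> \<in> space (prob_algebra borel)"
  shows "moment_matrix \<phi> \<nu> $ i $ j = (LINT x|\<nu>. \<phi> i x * cnj (\<phi> j x))"
proof -
  have "bounded_linear (\<lambda>A :: complex ^ 'n ^ 'n. A $ i $ j)"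
    using bounded_linear_compose[OF bounded_linear_vec_nth bounded_linear_vec_nth] .
  from integral_bounded_linear[OF this integrable_outer[OF assms]] show ?thesis
    by (simp add: moment_matrix_def outer_def vec_at_def)
qed

lemma norm_det_moment_matrix_le:
  assumes "\<nu> \<in> space (prob_algebra borel)"
  shows "cmod (det (moment_matrix \<phi> \<nu>)) \<le> real (card {p. p permutes (UNIV :: 'n set)}) * (K * K) ^ CARD('n)"
proof (rule norm_det_le)
  fix i j
  interpret prob_space \<nu> using assms by (simp add: space_prob_algebra)
  have "cmod (moment_matrix \<phi> \<nu> $ i $ j) \<le> (LINT x|\<nu>. cmod (\<phi> i x * cnj (\<phi> j x)))"
    unfolding moment_matrix_nth[OF assms] by (rule integral_norm_bound)
  also have "\<dots> \<le> (LINT x|\<nu>. K * K)"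
    by (intro integral_mono integrable_norm integrable_entry assms) (auto simp: cmod_entry simp del: norm_mult)
  finally show "cmod (moment_matrix \<phi> \<nu> $ i $ j) \<le> K * K"
    by (simp add: prob_space)
qed

text \<open>The mixture is built as a \<open>bind\<close> over a Bernoulli variable that selects
  \<open>\<nu>\<close> or the point mass at \<open>x\<close>, so that it inherits being a Borel
  probability measure.\<close>

lemma moment_matrix_mixture:
  assumes "\<nu> \<in> space (prob_algebra borel)" and t: "0 \<le> t" "t \<le> 1"
  obtains \<nu>' where "\<nu>' \<in> space (prob_algebra borel)"
    "moment_matrix \<phi> \<nu>' = (1 - t) *\<^sub>R moment_matrix \<phi> \<nu> + t *\<^sub>R outer (vec_at \<phi> x)"
proof
  interpret prob_space \<nu> using assms by (simp add: space_prob_algebra)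
  define N where "N = (\<lambda>b. if b then return borel x else \<nu>)"
  define \<nu>' where "\<nu>' = measure_pmf (bernoulli_pmf t) \<bind> N"
  have N: "N b \<in> space (prob_algebra borel)" for b
    using assms(1) by (simp add: N_def space_prob_algebra prob_space_return)
  then have N_meas: "N \<in> measurable (measure_pmf (bernoulli_pmf t)) (prob_algebra borel)"
    by simp
  show \<nu>': "\<nu>' \<in> space (prob_algebra borel)"
    using prob_space_bind'[OF _ N_meas] sets_bind'[OF _ N_meas]
    by (simp add: \<nu>'_def space_prob_algebra measure_pmf.prob_space_axioms)
  \<comment> \<open>Integration against the mixture is computed for bounded real functions; the
    complex entries of the moment matrix are then treated through real and imaginary parts.\<close>
  have real: "integral\<^sup>L \<nu>' f = (1 - t) * integral\<^sup>L \<nu> f + t * f x"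
    if f: "f \<in> borel_measurable borel" "\<And>y. \<bar>f y\<bar> \<le> C" for f :: "'a \<Rightarrow> real" and C
  proof -
    have "integral\<^sup>L \<nu>' f = (\<integral>b. integral\<^sup>L (N b) f \<partial>measure_pmf (bernoulli_pmf t))"
      unfolding \<nu>'_def
    proof (rule integral_bind[where B' = 1 and K = borel and B = C, OF f])
      show "N \<in> measurable (measure_pmf (bernoulli_pmf t)) (subprob_algebra borel)"
        by (rule measurable_prob_algebraD[OF N_meas])
      show "AE b in measure_pmf (bernoulli_pmf t). emeasure (N b) (space (N b)) \<le> ennreal 1"
        using N by (intro AE_I2) (simp add: space_prob_algebra prob_space.emeasure_space_1)
    qed (rule measure_pmf.finite_measure_axioms)
    then show ?thesis
      using t f by (simp add: N_def integral_return mult.commute)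
  qed
  show "moment_matrix \<phi> \<nu>' = (1 - t) *\<^sub>R moment_matrix \<phi> \<nu> + t *\<^sub>R outer (vec_at \<phi> x)"
    unfolding vec_eq_iff
  proof (intro allI)
    fix i j
    let ?f = "\<lambda>x. \<phi> i x * cnj (\<phi> j x)"
    note Re = real[of "\<lambda>x. Re (?f x)" "K * K", OF _ order_trans[OF abs_Re_le_cmod cmod_entry]]
      and Im = real[of "\<lambda>x. Im (?f x)" "K * K", OF _ order_trans[OF abs_Im_le_cmod cmod_entry]]
    have "integral\<^sup>L \<nu>' ?f = (1 - t) *\<^sub>R integral\<^sup>L \<nu> ?f + t *\<^sub>R ?f x"
      using Re[OF measurable_compose[OF measurable_entry borel_measurable_Re]]
        Im[OF measurable_compose[OF measurable_entry borel_measurable_Im]]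
        integral_Re[OF integrable_entry[OF \<nu>', of i j]] integral_Im[OF integrable_entry[OF \<nu>', of i j]]
        integral_Re[OF integrable_entry[OF assms(1), of i j]] integral_Im[OF integrable_entry[OF assms(1), of i j]]
      by (intro complex_eqI) (simp_all del: times_complex.simps)
    then show "moment_matrix \<phi> \<nu>' $ i $ j
      = ((1 - t) *\<^sub>R moment_matrix \<phi> \<nu> + t *\<^sub>R outer (vec_at \<phi> x)) $ i $ j"
      by (simp add: moment_matrix_nth[OF \<nu>'] moment_matrix_nth[OF assms(1)] outer_def vec_at_def)
  qed
qed

text \<open>The supremum of \<open>|det M(\<nu>)|\<close> need not be attained, so we work with a nearly maximising
  \<open>\<nu>\<close> and compare it with its mixtures with point masses.\<close>

lemma nearly_optimal:
  assumes "\<mu> \<in> space (prob_algebra borel)" "invertible (moment_matrix \<phi> \<mu>)"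
    and \<eta>: "0 < \<eta>" "\<eta> < 1"
  obtains \<nu> where "\<nu> \<in> space (prob_algebra borel)" "invertible (moment_matrix \<phi> \<nu>)"
    "\<And>x. hquad (matrix_inv (moment_matrix \<phi> \<nu>)) (vec_at \<phi> x) \<le> real CARD('n) + \<eta>"
proof -
  define d where "d \<nu> = cmod (det (moment_matrix \<phi> \<nu>))" for \<nu>
  define P where "P = space (prob_algebra (borel :: 'a measure))"
  define m where "m = CARD('n) - 1"
  have n: "CARD('n) = Suc m"
    by (simp add: m_def)
  have bdd: "bdd_above (d ` P)"
    unfolding bdd_above_def d_def P_def using norm_det_moment_matrix_le by blast
  define D where "D = Sup (d ` P)"
  have le_D: "d \<nu> \<le> D" if "\<nu> \<in> P" for \<nu>
    unfolding D_def by (intro cSUP_upper that bdd)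
  have "0 < d \<mu>"
    using assms(2) by (simp add: d_def invertible_det_nz)
  then have D: "D > 0"
    using le_D[of \<mu>] assms(1) by (simp add: P_def)
  \<comment> \<open>Solves \<open>(real m + \<eta>) * (1 - real m * t) = real m + t\<close>, see
    \<open>t_eq\<close>; this is the relation that turns the final comparison into q - 1 < m +
    \<eta>.\<close>
  define t where "t = \<eta> / (1 + real m * (real m + \<eta>))"
  have den: "1 + real m * (real m + \<eta>) \<ge> 1"
    using \<eta> by simp
  have t: "0 < t" "t < 1" "real m * t < 1"
  proof -
    show "0 < t"
      unfolding t_def using \<eta> den by (intro divide_pos_pos) linarith+
    show "t < 1"
      unfolding t_def using \<eta> den by (subst divide_less_eq_1_pos) linarith+
    have "real m * \<eta> \<le> real m * (real m + \<eta>)"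
      using \<eta> by (intro mult_left_mono) auto
    then have "real m * \<eta> < 1 + real m * (real m + \<eta>)"
      by linarith
    then show "real m * t < 1"
      unfolding t_def using den by (simp add: divide_less_eq)
  qed
  have "t * (1 + real m * (real m + \<eta>)) = \<eta>"
    unfolding t_def using den by simp
  then have t_eq: "(real m + \<eta>) * (1 - real m * t) = real m + t"
    by (simp add: algebra_simps)
  \<comment> \<open>\<open>\<nu>\<close> is taken within a factor 1 + t^2 of the supremum. This
    defect is of second order, so it costs only \<open>t\<close> once the first-order comparison is
    divided by \<open>t\<close>.\<close>
  have "D * 1 < D * (1 + t\<^sup>2)"
    using D t by (intro mult_strict_left_mono) auto
  then have "D / (1 + t\<^sup>2) < D"
    by (subst divide_less_eq) (auto simp: add_pos_nonneg)
  then obtain \<nu> where \<nu>: "\<nu> \<in> P" "D / (1 + t\<^sup>2) < d \<nu>"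
    unfolding D_def using bdd assms(1) less_cSUP_iff[of P d] by (auto simp: P_def)
  have d\<nu>: "D < (1 + t\<^sup>2) * d \<nu>"
    using \<nu>(2) t by (simp add: field_simps add_pos_nonneg)
  moreover have "0 < 1 + t\<^sup>2"
    by (simp add: add_pos_nonneg)
  ultimately have "d \<nu> > 0"
    using D by (metis less_trans zero_less_mult_pos)
  then have inv: "invertible (moment_matrix \<phi> \<nu>)"
    by (simp add: d_def invertible_det_nz)
  have "hquad (matrix_inv (moment_matrix \<phi> \<nu>)) (vec_at \<phi> x) \<le> real CARD('n) + \<eta>" for x
  \<comment> \<open>When the form exceeds 1, the factor \<open>1 + t * (q - 1)\<close> is positive
    and Bernoulli's inequality may be multiplied by it.\<close>
  proof (cases "hquad (matrix_inv (moment_matrix \<phi> \<nu>)) (vec_at \<phi> x) \<le> 1")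
    case True
    then show ?thesis using \<eta> n by simp
  next
    case False
    define v where "v = vec_at \<phi> x"
    define z where "z = cdot v (matrix_inv (moment_matrix \<phi> \<nu>) *v v)"
    define q where "q = Re z"
    have hq: "hquad (matrix_inv (moment_matrix \<phi> \<nu>)) (vec_at \<phi> x) = q"
      by (simp add: hquad_cdot q_def z_def v_def)
    with False have q: "q > 1" by simp
    obtain \<nu>' where \<nu>': "\<nu>' \<in> P"
      and mm: "moment_matrix \<phi> \<nu>' = (1 - t) *\<^sub>R moment_matrix \<phi> \<nu> + t *\<^sub>R outer v"
      using moment_matrix_mixture[of \<nu> t x] \<nu>(1) t by (auto simp: P_def v_def)
    \<comment> \<open>The determinant of the mixture needs only a lower bound in modulus, and the
      real part provides one.\<close>
    have "Re (1 + complex_of_real (t / (1 - t)) * z) = 1 + t / (1 - t) * q"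
      by (simp add: q_def)
    then have z: "1 + t / (1 - t) * q \<le> cmod (1 + complex_of_real (t / (1 - t)) * z)"
      by (metis complex_Re_le_cmod)
    have "d \<nu>' = (1 - t) ^ Suc m * (d \<nu> * cmod (1 + complex_of_real (t / (1 - t)) * z))"
      using t by (simp add: d_def mm det_convex_outer[OF inv] n norm_mult norm_power z_def
          norm_of_real[of "1 - t", where 'a=complex, simplified])
    also have "\<dots> \<ge> (1 - t) ^ Suc m * (d \<nu> * (1 + t / (1 - t) * q))"
      using t z \<open>d \<nu> > 0\<close> by (intro mult_left_mono) auto
    finally have "(1 - t) ^ Suc m * (d \<nu> * (1 + t / (1 - t) * q)) \<le> d \<nu>'" .
    moreover have "(1 - t) ^ Suc m * (d \<nu> * (1 + t / (1 - t) * q))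
      = d \<nu> * ((1 - t) ^ m * ((1 - t) * (1 + t / (1 - t) * q)))"
      by (simp only: power_Suc mult_ac)
    moreover have "(1 - t) * (1 + t / (1 - t) * q) = 1 + t * (q - 1)"
      using t by (simp add: field_simps)
    ultimately have "d \<nu> * ((1 - t) ^ m * (1 + t * (q - 1))) \<le> d \<nu>'"
      by (simp only:)
    also have "\<dots> < d \<nu> * (1 + t\<^sup>2)"
      using le_D[OF \<nu>'] d\<nu> by (simp add: mult.commute)
    finally have "d \<nu> * ((1 - t) ^ m * (1 + t * (q - 1))) < d \<nu> * (1 + t\<^sup>2)" .
    then have "(1 - t) ^ m * (1 + t * (q - 1)) < 1 + t\<^sup>2"
      using \<open>d \<nu> > 0\<close> by simp
    moreover have "(1 - real m * t) * (1 + t * (q - 1)) \<le> (1 - t) ^ m * (1 + t * (q - 1))"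
      using Bernoulli_inequality[of "- t" m] t q by (intro mult_right_mono) auto
    ultimately have "t * ((q - 1) * (1 - real m * t)) < t * (real m + t)"
      by (simp add: algebra_simps power2_eq_square)
    then have "(q - 1) * (1 - real m * t) < (real m + \<eta>) * (1 - real m * t)"
      using t by (simp add: t_eq)
    then have "q - 1 < real m + \<eta>"
      using t by (subst (asm) mult_less_cancel_right_pos) auto
    then show ?thesis
      unfolding hq by (simp add: n)
  qed
  with \<nu>(1) inv show ?thesis
    by (intro that) (auto simp: P_def)
qed

text \<open>Optimality is a minimax property, so the supremum for \<open>\<mu>\<close> is at most
  the one for each \<open>\<nu>\<close> of \<open>nearly_optimal\<close>, that is, at most n +
  \<eta> for every small \<eta>. This does not pass through the equality of the two
  characterisations of optimal measures.\<close>

theorem Kiefer_Wolfowitz_bound: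
  assumes "optimal_measure \<phi> \<mu>"
  shows "hquad (matrix_inv (moment_matrix \<phi> \<mu>)) (vec_at \<phi> x) \<le> real CARD('n)"
proof (rule field_le_epsilon)
  fix e :: real assume "e > 0"
  define \<eta> where "\<eta> = min e (1 / 2)"
  have \<eta>: "0 < \<eta>" "\<eta> < 1"
    using \<open>e > 0\<close> by (auto simp: \<eta>_def min_def)
  let ?G = "\<lambda>\<nu>. SUP x. ereal (hquad (matrix_inv (moment_matrix \<phi> \<nu>)) (vec_at \<phi> x))"
  have \<mu>: "\<mu> \<in> space (prob_algebra borel)" "invertible (moment_matrix \<phi> \<mu>)"
    and opt: "\<And>\<nu>. \<nu> \<in> space (prob_algebra borel) \<Longrightarrow> invertible (moment_matrix \<phi> \<nu>) \<Longrightarrow> ?G \<mu> \<le> ?G \<nu>"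
    using assms by (auto simp: optimal_measure_def is_arg_min_def not_less)
  obtain \<nu> where \<nu>: "\<nu> \<in> space (prob_algebra borel)" "invertible (moment_matrix \<phi> \<nu>)"
    "\<And>x. hquad (matrix_inv (moment_matrix \<phi> \<nu>)) (vec_at \<phi> x) \<le> real CARD('n) + \<eta>"
    using nearly_optimal[OF \<mu> \<eta>] by blast
  have "ereal (hquad (matrix_inv (moment_matrix \<phi> \<mu>)) (vec_at \<phi> x)) \<le> ?G \<mu>"
    by (rule SUP_upper) simp
  also have "\<dots> \<le> ?G \<nu>"
    by (rule opt[OF \<nu>(1,2)])
  also have "\<dots> \<le> ereal (real CARD('n) + \<eta>)"
    by (rule SUP_least) (use \<nu>(3) in simp)
  finally show "hquad (matrix_inv (moment_matrix \<phi> \<mu>)) (vec_at \<phi> x) \<le> real CARD('n) + e"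
    by (simp add: \<eta>_def)
qed

end

section \<open>Coordinates and change of basis\<close>

lemma is_basis_combination:
  assumes "is_basis \<phi> V"
  shows "v \<in> V \<longleftrightarrow> (\<exists>c :: complex ^ 'n. v = (\<lambda>x. \<Sum>i\<in>UNIV. c $ i * \<phi> (i :: 'n :: finite) x))"
proof -
  have inj: "inj \<phi>" and V: "cfun.span (range \<phi>) = V"
    using assms by (auto simp: is_basis_def)
  have sum_apply: "(\<Sum>i\<in>A. f i) x = (\<Sum>i\<in>A. f i x)" for f :: "'n \<Rightarrow> 'b \<Rightarrow> complex" and A x
    by (induction A rule: infinite_finite_induct) auto
  \<comment> \<open>\<open>cfun.span_finite\<close> attaches coefficients to the functions in the
    range; injectivity of \<open>\<phi>\<close> moves them to the indices.\<close>
  have "V = range (\<lambda>u. \<Sum>i\<in>UNIV. fscale (u (\<phi> i)) (\<phi> i))"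
    unfolding V[symmetric] by (subst cfun.span_finite) (simp_all add: sum.reindex[OF inj] o_def)
  then have "v \<in> V \<longleftrightarrow> (\<exists>u. v = (\<lambda>x. \<Sum>i\<in>UNIV. u (\<phi> i) * \<phi> i x))"
    by (auto simp: fscale_def fun_eq_iff sum_apply)
  also have "\<dots> \<longleftrightarrow> (\<exists>c :: complex ^ 'n. v = (\<lambda>x. \<Sum>i\<in>UNIV. c $ i * \<phi> i x))"
  proof (intro iffI; elim exE)
    fix u assume "v = (\<lambda>x. \<Sum>i\<in>UNIV. u (\<phi> i) * \<phi> i x)"
    then show "\<exists>c :: complex ^ 'n. v = (\<lambda>x. \<Sum>i\<in>UNIV. c $ i * \<phi> i x)"
      by (intro exI[of _ "\<chi> i. u (\<phi> i)"]) simp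
  next
    fix c :: "complex ^ 'n" assume "v = (\<lambda>x. \<Sum>i\<in>UNIV. c $ i * \<phi> i x)"
    then show "\<exists>u. v = (\<lambda>x. \<Sum>i\<in>UNIV. u (\<phi> i) * \<phi> i x)"
      by (intro exI[of _ "\<lambda>f. c $ (inv \<phi> f)"]) (simp add: inj)
  qed
  finally show ?thesis .
qed

text \<open>Optimality refers to \<open>\<psi>\<close>, the algorithm to the orthonormal
  \<open>\<phi>\<close>. With \<phi> = T \<psi>, orthonormality says T M (adj T) = I for the moment
  matrix M of \<open>\<psi>\<close>, hence M^-1 = (adj T) T, and the form bounded by
  Kiefer-Wolfowitz becomes |T \<psi>(x)|^2.\<close>

lemma orthonormal_norm_le:
  fixes \<phi> \<psi> :: "'n::finite \<Rightarrow> 'a::topological_space \<Rightarrow> complex"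
  assumes \<psi>: "bounded_family \<psi> K" and \<phi>: "bounded_family \<phi> K'"
    and "is_basis \<psi> V" "is_basis \<phi> V"
    and opt: "optimal_measure \<psi> \<mu>" and ortho: "orthonormal_on \<mu> \<phi>"
  shows "(norm (vec_at \<phi> x))\<^sup>2 \<le> real CARD('n)"
proof -
  interpret \<psi>: bounded_family \<psi> K by fact
  interpret \<phi>: bounded_family \<phi> K' by fact
  have \<mu>: "\<mu> \<in> space (prob_algebra borel)"
    using opt by (auto simp: optimal_measure_def is_arg_min_def)
  have "\<phi> i \<in> V" for i
    using assms(4) by (auto simp: is_basis_def intro: cfun.span_base)
  then have "\<exists>c :: complex ^ 'n. \<forall>x. \<phi> i x = (\<Sum>j\<in>UNIV. c $ j * \<psi> j x)" for i
    unfolding is_basis_combination[OF assms(3)] fun_eq_iff .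
  then obtain c :: "'n \<Rightarrow> complex ^ 'n" where c: "\<And>i x. \<phi> i x = (\<Sum>j\<in>UNIV. c i $ j * \<psi> j x)"
    by metis
  define T where "T = (\<chi> i. c i)"
  have vT: "vec_at \<phi> x = T *v vec_at \<psi> x" for x
    by (simp add: vec_eq_iff vec_at_def c T_def matrix_vector_mult_def)
  have "T ** outer v ** adj T = outer (T *v v)" for v
    by (simp add: vec_eq_iff outer_def adj_def matrix_matrix_mult_def matrix_vector_mult_def
        sum_distrib_left sum_distrib_right mult_ac)
  then have outer: "outer (vec_at \<phi> x) = T ** outer (vec_at \<psi> x) ** adj T" for x
    by (simp add: vT)
  have "linear (\<lambda>A. T ** A ** adj T)"
    by (intro linearI) (simp_all add: matrix_add_ldistrib matrix_add_rdistrib scaleR_mult_left scaleR_mult_right)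
  then have "bounded_linear (\<lambda>A. T ** A ** adj T)"
    by (simp add: linear_conv_bounded_linear)
  from integral_bounded_linear[OF this \<psi>.integrable_outer[OF \<mu>]]
  have "moment_matrix \<phi> \<mu> = T ** moment_matrix \<psi> \<mu> ** adj T"
    by (simp add: moment_matrix_def outer)
  moreover have "moment_matrix \<phi> \<mu> = mat 1"
    using ortho by (simp add: vec_eq_iff \<phi>.moment_matrix_nth[OF \<mu>] orthonormal_on_def mat_def)
  ultimately have "T ** (moment_matrix \<psi> \<mu> ** adj T) = mat 1"
    by (simp add: matrix_mul_assoc)
  then have "moment_matrix \<psi> \<mu> ** adj T ** T = mat 1"
    by (simp add: matrix_left_right_inverse)
  then have "matrix_inv (moment_matrix \<psi> \<mu>) = adj T ** T"
    by (intro matrix_inv_eqI) (simp add: matrix_mul_assoc)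
  then have "hquad (matrix_inv (moment_matrix \<psi> \<mu>)) (vec_at \<psi> x) = (norm (vec_at \<phi> x))\<^sup>2"
    using hquad_congruence[of T "mat 1" "vec_at \<psi> x"] hquad_mat[of 1 "vec_at \<phi> x"] by (simp add: vT)
  then show ?thesis
    using \<psi>.Kiefer_Wolfowitz_bound[OF opt] by metis
qed

section \<open>Measurability of the algorithm\<close>

lemma borel_measurable_vec_nth [measurable (raw)]:
  fixes f :: "'a \<Rightarrow> 'b :: topological_space ^ 'n"
  assumes "f \<in> borel_measurable M"
  shows "(\<lambda>x. f x $ i) \<in> borel_measurable M"
  by (rule measurable_compose[OF assms borel_measurable_continuous_onI]) (intro continuous_intros)

lemma borel_measurable_vec_lambda [measurable (raw)]:
  fixes f :: "'n :: finite \<Rightarrow> 'a \<Rightarrow> 'b :: euclidean_space"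
  assumes "\<And>i. f i \<in> borel_measurable M"
  shows "(\<lambda>x. \<chi> i. f i x) \<in> borel_measurable M"
  by (rule borel_measurable_vec) (simp add: assms)

lemma borel_measurable_det [measurable (raw)]:
  fixes A :: "'a \<Rightarrow> complex ^ 'n ^ 'n"
  assumes [measurable]: "A \<in> borel_measurable M"
  shows "(\<lambda>x. det (A x)) \<in> borel_measurable M"
  unfolding det_def by measurable

lemma borel_measurable_matrix_mult [measurable (raw)]:
  fixes A B :: "'a \<Rightarrow> complex ^ 'n ^ 'n"
  assumes [measurable]: "A \<in> borel_measurable M" "B \<in> borel_measurable M"
  shows "(\<lambda>x. A x ** B x) \<in> borel_measurable M"
  unfolding matrix_matrix_mult_def by measurable

lemma borel_measurable_trace [measurable (raw)]:
  fixes A :: "'a \<Rightarrow> complex ^ 'n ^ 'n"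
  assumes [measurable]: "A \<in> borel_measurable M"
  shows "(\<lambda>x. trace (A x)) \<in> borel_measurable M"
  unfolding trace_def by measurable

lemma borel_measurable_mat [measurable (raw)]:
  fixes c :: "'a \<Rightarrow> complex"
  assumes [measurable]: "c \<in> borel_measurable M"
  shows "(\<lambda>x. mat (c x) :: complex ^ 'n ^ 'n) \<in> borel_measurable M"
  unfolding mat_def by measurable

lemma borel_measurable_cnj [measurable (raw)]:
  assumes "f \<in> borel_measurable M"
  shows "(\<lambda>x. cnj (f x)) \<in> borel_measurable M"
  by (rule measurable_compose[OF assms borel_measurable_continuous_onI]) (intro continuous_intros)

lemma borel_measurable_hquad [measurable (raw)]:
  fixes A :: "'a \<Rightarrow> complex ^ 'n ^ 'n"
  assumes [measurable]: "A \<in> borel_measurable M" "v \<in> borel_measurable M"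
  shows "(\<lambda>x. hquad (A x) (v x)) \<in> borel_measurable M"
  unfolding hquad_def matrix_vector_mult_def vec_lambda_beta by measurable

lemma borel_measurable_outer [measurable (raw)]:
  fixes v :: "'a \<Rightarrow> complex ^ 'n"
  assumes [measurable]: "v \<in> borel_measurable M"
  shows "(\<lambda>x. outer (v x)) \<in> borel_measurable M"
  unfolding outer_def by measurable

text \<open>On singular matrices \<open>matrix_inv\<close> is a choice from the empty predicate, hence constant.\<close>

lemma matrix_inv_cramer:
  fixes A :: "complex ^ 'n ^ 'n"
  shows "matrix_inv A = (if det A = 0 then matrix_inv 0
    else \<chi> k j. det (\<chi> i l. if l = k then axis j 1 $ i else A $ i $ l) / det A)"
proof (cases "det A = 0")
  case True
  moreover have "det (0 :: complex ^ 'n ^ 'n) = 0"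
    using det_0 by (metis mat_0)
  ultimately have "\<not> invertible A" "\<not> invertible (0 :: complex ^ 'n ^ 'n)"
    by (simp_all add: invertible_det_nz)
  then have "(\<lambda>B. A ** B = mat 1 \<and> B ** A = mat 1)
    = (\<lambda>B :: complex ^ 'n ^ 'n. 0 ** B = mat 1 \<and> B ** 0 = mat 1)"
    unfolding invertible_def by blast
  then show ?thesis
    using True by (simp add: matrix_inv_def)
next
  case False
  have "matrix_inv A $ k $ j = det (\<chi> i l. if l = k then axis j 1 $ i else A $ i $ l) / det A" for k j
  proof -
    have "A *v (matrix_inv A *v axis j 1) = axis j 1"
      using matrix_inv_mult(1)[of A] False by (simp add: matrix_vector_mul_assoc invertible_det_nz)
    then have "(matrix_inv A *v axis j 1) $ k = det (\<chi> i l. if l = k then axis j 1 $ i else A $ i $ l) / det A"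
      by (simp add: cramer[OF False])
    moreover have "(matrix_inv A *v axis j 1) $ k = matrix_inv A $ k $ j"
      by (simp add: matrix_vector_mult_def axis_def if_distrib[of "\<lambda>a. _ * a"] cong: if_cong)
    ultimately show ?thesis by simp
  qed
  then show ?thesis
    using False by (simp add: vec_eq_iff)
qed

lemma borel_measurable_matrix_inv [measurable (raw)]:
  fixes A :: "'a \<Rightarrow> complex ^ 'n ^ 'n"
  assumes [measurable]: "A \<in> borel_measurable M"
  shows "(\<lambda>x. matrix_inv (A x)) \<in> borel_measurable M"
  by (subst matrix_inv_cramer) measurable

lemma borel_measurable_shift_mat [measurable (raw)]:
  fixes A :: "'a \<Rightarrow> complex ^ 'n ^ 'n"
  assumes [measurable]: "A \<in> borel_measurable M"
  shows "(\<lambda>x. shift_mat (A x) l) \<in> borel_measurable M"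
  unfolding shift_mat_def by measurable

lemma borel_measurable_W_mat [measurable (raw)]:
  fixes A :: "'a \<Rightarrow> complex ^ 'n ^ 'n"
  assumes [measurable]: "A \<in> borel_measurable M"
  shows "(\<lambda>x. W_mat \<delta> (A x) l) \<in> borel_measurable M"
  unfolding W_mat_def Let_def by measurable

lemma ell_eq: "ell n \<delta> i = real i * \<delta> - real n"
  by (induction i) (simp_all add: algebra_simps)

lemma A_mat_cong:
  assumes "\<And>j. j \<in> {1..i} \<Longrightarrow> x j = y j"
  shows "A_mat \<phi> \<delta> \<kappa> x i = A_mat \<phi> \<delta> \<kappa> y i"
  using assms by (induction i) auto

section \<open>The sampling kernel of one step and its measurability\<close>

locale point_selection = bounded_family \<phi> K for \<phi> :: "'n::finite \<Rightarrow> 'a::topological_space \<Rightarrow> complex" and K +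
  fixes \<mu> :: "'a measure" and \<delta> :: real
  assumes \<mu>: "\<mu> \<in> space (prob_algebra borel)"
    and ortho: "orthonormal_on \<mu> \<phi>"
    and \<delta>: "0 < \<delta>" "\<delta> < 1"
begin

sublocale prob_space \<mu>
  using \<mu> by (simp add: space_prob_algebra)

lemma sets_\<mu> [measurable_cong]: "sets \<mu> = sets borel"
  using \<mu> by (simp add: space_prob_algebra)

lemma space_\<mu> [simp]: "space \<mu> = UNIV"
  using sets_eq_imp_space_eq[OF sets_\<mu>] by simp

abbreviation "A x i \<equiv> A_mat \<phi> \<delta> 1 x i"
abbreviation "\<theta> \<equiv> (1 - \<delta>) / \<delta>"
abbreviation "R B i y \<equiv> R_fun \<phi> \<delta> 1 B (ell CARD('n) \<delta> i) y"

lemma \<theta>_pos: "\<theta> > 0"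
  using \<delta> by simp

lemma measurable_vec_at [measurable]:
  assumes [measurable]: "f \<in> measurable M borel"
  shows "(\<lambda>x. vec_at \<phi> (f x)) \<in> borel_measurable M"
  unfolding vec_at_def by (intro borel_measurable_vec_lambda measurable_compose[OF assms meas])

lemma measurable_R [measurable]:
  assumes [measurable]: "f \<in> measurable M borel" "B \<in> borel_measurable M"
  shows "(\<lambda>x. R (B x) i (f x)) \<in> borel_measurable M"
  unfolding R_fun_def Let_def by measurable

lemma R_nonneg: "0 \<le> R B i y"
  using \<theta>_pos by (auto simp: R_fun_def Let_def)

lemma R_pos_iff: "0 < R B i y \<longleftrightarrow> \<theta> \<le> hquad (W_mat \<delta> B (ell CARD('n) \<delta> i)) (vec_at \<phi> y)"
  using \<theta>_pos by (auto simp: R_fun_def Let_def)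

lemma R_ge: "0 < R B i y \<Longrightarrow> \<theta> \<le> R B i y"
  using \<theta>_pos by (auto simp: R_fun_def Let_def split: if_splits)

lemma measurable_R_point [measurable]: "R B i \<in> borel_measurable borel"
  by measurable

abbreviation "PM (m :: nat) \<equiv> Pi\<^sub>M {1..m} (\<lambda>i. \<mu>)"

lemma measurable_point:
  assumes "i \<in> {1..m}"
  shows "(\<lambda>x. x i) \<in> measurable (PM m) borel"
  using measurable_component_singleton[OF assms, of "\<lambda>i. \<mu>"]
  by (simp only: measurable_cong_sets[OF refl sets_\<mu>])

lemma measurable_A [measurable]: "i \<le> m \<Longrightarrow> (\<lambda>x. A x i) \<in> borel_measurable (PM m)"
proof (induction i)
  case 0
  then show ?case by simp
next
  case (Suc i)
  then have [measurable]: "(\<lambda>x. A x i) \<in> borel_measurable (PM m)"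
    by simp
  have [measurable]: "(\<lambda>x. x (Suc i)) \<in> measurable (PM m) borel"
    using Suc.prems by (intro measurable_point) simp
  show ?case
    unfolding A_mat.simps by measurable
qed

text \<open>Expressing breakdown by the density 0 puts all histories under one density formula,
  which can then be shown jointly measurable in history and point.\<close>

lemma algB_step_eq:
  "algB_step \<phi> \<mu> \<delta> 1 i x = density \<mu> (\<lambda>y. if invertible (shift_mat (A x i) (ell CARD('n) \<delta> i))
      \<and> invertible (shift_mat (A x i) (ell CARD('n) \<delta> i + \<delta>))
      \<and> trace (matrix_inv (shift_mat (A x i) (ell CARD('n) \<delta> i + \<delta>))) \<noteq> trace (matrix_inv (shift_mat (A x i) (ell CARD('n) \<delta> i)))
      \<and> 0 < (LINT y|\<mu>. R (A x i) i y)
    then ennreal (R (A x i) i y / (LINT y|\<mu>. R (A x i) i y)) else 0)"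
proof -
  have "density \<mu> (\<lambda>_. 0) = null_measure \<mu>"
    by (rule measure_eqI) (auto simp: emeasure_density)
  then show ?thesis
    unfolding algB_step_def Let_def by (auto cong: if_cong)
qed

lemma prob_space_R:
  assumes \<Gamma>: "0 < (LINT y|\<mu>. R B i y)"
  shows "prob_space (density \<mu> (\<lambda>y. ennreal (R B i y / (LINT y|\<mu>. R B i y))))"
proof
  \<comment> \<open>A Bochner integral different from 0 forces integrability.\<close>
  have "integrable \<mu> (R B i)"
    using \<Gamma> not_integrable_integral_eq by fastforce
  then have "(\<integral>\<^sup>+ y. ennreal (R B i y / (LINT y|\<mu>. R B i y)) \<partial>\<mu>)
    = ennreal (LINT y|\<mu>. R B i y / (LINT y|\<mu>. R B i y))"
    using \<Gamma> R_nonneg by (intro nn_integral_eq_integral) (auto intro!: AE_I2 divide_nonneg_pos)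
  then have *: "(\<integral>\<^sup>+ y. ennreal (R B i y / (LINT y|\<mu>. R B i y)) \<partial>\<mu>) = 1"
    using \<Gamma> by simp
  let ?D = "density \<mu> (\<lambda>y. ennreal (R B i y / (LINT y|\<mu>. R B i y)))"
  have "emeasure ?D (space \<mu>) = (\<integral>\<^sup>+ y. ennreal (R B i y / (LINT y|\<mu>. R B i y)) * indicator (space \<mu>) y \<partial>\<mu>)"
    by (rule emeasure_density; measurable)
  then show "emeasure ?D (space ?D) = 1"
    using * by simp
qed

lemma measurable_algB_step: "algB_step \<phi> \<mu> \<delta> 1 m \<in> measurable (PM m) (subprob_algebra \<mu>)"
proof (rule measurable_subprob_algebra)
  fix x
  show "sets (algB_step \<phi> \<mu> \<delta> 1 m x) = sets \<mu>"
    by (simp add: algB_step_eq)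
  show "subprob_space (algB_step \<phi> \<mu> \<delta> 1 m x)"
  proof -
    have "subprob_space (null_measure \<mu>)"
      by (rule subprob_spaceI) auto
    then show ?thesis
      unfolding algB_step_def Let_def
      using prob_space_R[THEN prob_space_imp_subprob_space] by (auto split: if_split)
  qed
next
  fix S assume S [measurable]: "S \<in> sets \<mu>"
  have [measurable]: "(\<lambda>x. A x m) \<in> borel_measurable (PM m)"
    by (rule measurable_A) simp
  \<comment> \<open>Invertibility is restated as a nonzero determinant, a visibly measurable
    condition on the history.\<close>
  define D where "D = (\<lambda>x y. if det (shift_mat (A x m) (ell CARD('n) \<delta> m)) \<noteq> 0
      \<and> det (shift_mat (A x m) (ell CARD('n) \<delta> m + \<delta>)) \<noteq> 0
      \<and> trace (matrix_inv (shift_mat (A x m) (ell CARD('n) \<delta> m + \<delta>)))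
        \<noteq> trace (matrix_inv (shift_mat (A x m) (ell CARD('n) \<delta> m)))
      \<and> 0 < (LINT y|\<mu>. R (A x m) m y)
    then ennreal (R (A x m) m y / (LINT y|\<mu>. R (A x m) m y)) else 0)"
  have [measurable]: "case_prod D \<in> borel_measurable (PM m \<Otimes>\<^sub>M \<mu>)"
    unfolding D_def by measurable
  have [measurable]: "D x \<in> borel_measurable \<mu>" for x
    unfolding D_def by measurable
  have "algB_step \<phi> \<mu> \<delta> 1 m x = density \<mu> (D x)" for x
    unfolding algB_step_eq invertible_det_nz D_def ..
  then have "emeasure (algB_step \<phi> \<mu> \<delta> 1 m x) S = (\<integral>\<^sup>+ y. D x y * indicator S y \<partial>\<mu>)" for x
    by (simp add: emeasure_density)
  moreover have "(\<lambda>x. \<integral>\<^sup>+ y. D x y * indicator S y \<partial>\<mu>) \<in> borel_measurable (PM m)"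
    by measurable
  ultimately show "(\<lambda>x. emeasure (algB_step \<phi> \<mu> \<delta> 1 m x) S) \<in> borel_measurable (PM m)"
    by simp
qed


text \<open>The event that carries the whole proof: every one of the first \<open>m\<close> draws
  has positive density. The barrier and interpolation estimates hold for each such \<open>x\<close>,
  without exceptional sets.\<close>

definition good :: "(nat \<Rightarrow> 'a) \<Rightarrow> nat \<Rightarrow> bool"
  where "good x m \<longleftrightarrow> (\<forall>i<m. 0 < R (A x i) i (x (Suc i)))"

abbreviation "B x i \<equiv> shift_mat (A x i) (ell CARD('n) \<delta> i)"

lemma barrier_invariant:
  "good x i \<Longrightarrow> pos_def (B x i) \<and> Re (trace (matrix_inv (B x i))) = 1"
proof (induction i)
  case 0
  \<comment> \<open>The barrier starts at -n and the matrix at 0, so the first shifted matrix is n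
    I, whose inverse has trace n / n = 1.\<close>
  have B0: "B x 0 = mat (complex_of_real (real CARD('n)))"
    by (simp add: shift_mat_def vec_eq_iff mat_def)
  have "pos_def (B x 0)"
    unfolding pos_def_def B0 adj_mat hquad_mat by simp
  moreover have "B x 0 ** mat (complex_of_real (1 / real CARD('n))) = mat 1"
    unfolding B0 scaleR_eq_mat[symmetric]
    by (simp add: vec_eq_iff mat_def scaleR_conv_of_real[where 'a=complex])
  then have "matrix_inv (B x 0) = mat (complex_of_real (1 / real CARD('n)))"
    by (rule matrix_inv_eqI)
  then have "Re (trace (matrix_inv (B x 0))) = 1"
    by (simp add: trace_mat)
  ultimately show ?case ..
next
  case (Suc i)
  then have IH: "pos_def (B x i)" "Re (trace (matrix_inv (B x i))) = 1"
    and pos: "0 < R (A x i) i (x (Suc i))"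
    by (auto simp: good_def)
  then have "R (A x i) i (x (Suc i)) = hquad (W_mat \<delta> (A x i) (ell CARD('n) \<delta> i)) (vec_at \<phi> (x (Suc i)))"
    by (simp add: R_fun_def Let_def split: if_splits)
  from potential_step[OF IH(1) _ \<delta> this pos] IH(2) show ?case
    by simp
qed

lemma hquad_expand: "hquad C (vec_at \<phi> y) = Re (\<Sum>i\<in>UNIV. \<Sum>j\<in>UNIV. C $ i $ j * (\<phi> j y * cnj (\<phi> i y)))"
  by (simp add: hquad_def vec_at_def matrix_vector_mult_def sum_distrib_left mult_ac)

lemma integrable_hquad: "integrable \<mu> (\<lambda>y. hquad C (vec_at \<phi> y))"
  unfolding hquad_expand
  by (intro integrable_Re Bochner_Integration.integrable_sum integrable_mult_right integrable_entry \<mu>)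

text \<open>Orthonormality makes the integral of \<open>\<phi> j y * cnj (\<phi> i y)\<close> vanish
  off the diagonal, so only the diagonal of \<open>C\<close> survives.\<close>

lemma integral_hquad: "(LINT y|\<mu>. hquad C (vec_at \<phi> y)) = Re (trace C)"
proof -
  have "(LINT y|\<mu>. hquad C (vec_at \<phi> y))
    = Re (LINT y|\<mu>. (\<Sum>i\<in>UNIV. \<Sum>j\<in>UNIV. C $ i $ j * (\<phi> j y * cnj (\<phi> i y))))"
    unfolding hquad_expand
    by (intro integral_Re Bochner_Integration.integrable_sum integrable_mult_right integrable_entry \<mu>)
  also have "(LINT y|\<mu>. (\<Sum>i\<in>UNIV. \<Sum>j\<in>UNIV. C $ i $ j * (\<phi> j y * cnj (\<phi> i y))))
    = (\<Sum>i\<in>UNIV. \<Sum>j\<in>UNIV. C $ i $ j * (LINT y|\<mu>. \<phi> j y * cnj (\<phi> i y)))"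
    by (simp add: Bochner_Integration.integral_sum integrable_entry[OF \<mu>])
  also have "\<dots> = trace C"
    using ortho by (simp add: orthonormal_on_def trace_def if_distrib[of "\<lambda>a. _ * a"] cong: if_cong)
  finally show ?thesis .
qed

lemma integrable_R: "integrable \<mu> (R C i)"
proof (rule Bochner_Integration.integrable_bound[OF integrable_hquad[of "W_mat \<delta> C (ell CARD('n) \<delta> i)"]])
  show "AE y in \<mu>. norm (R C i y) \<le> norm (hquad (W_mat \<delta> C (ell CARD('n) \<delta> i)) (vec_at \<phi> y))"
    by (simp add: R_fun_def Let_def)
qed measurable

text \<open>The trace is the mean of w. If the truncated function had integral 0, then w would lie
  below the threshold almost everywhere, and its mean over a probability space would be strictly
  below it.\<close>

lemma integral_R_pos:
  assumes "\<theta> \<le> Re (trace (W_mat \<delta> C (ell CARD('n) \<delta> i)))"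
  shows "0 < (LINT y|\<mu>. R C i y)"
proof (rule ccontr)
  let ?w = "\<lambda>y. hquad (W_mat \<delta> C (ell CARD('n) \<delta> i)) (vec_at \<phi> y)"
  assume "\<not> 0 < (LINT y|\<mu>. R C i y)"
  moreover have "0 \<le> (LINT y|\<mu>. R C i y)"
    by (rule integral_nonneg_AE) (simp add: R_nonneg)
  ultimately have "(LINT y|\<mu>. R C i y) = 0"
    by simp
  then have "AE y in \<mu>. R C i y = 0"
    using integral_nonneg_eq_0_iff_AE[OF integrable_R] R_nonneg by simp
  then have "AE y in \<mu>. ?w y < \<theta>"
    by eventually_elim (metis R_pos_iff less_irrefl not_less)
  then have "(LINT y|\<mu>. ?w y) < (LINT y|\<mu>. \<theta>)"
    by (intro integral_less_AE_space integrable_hquad) (auto simp: emeasure_space_1[unfolded space_\<mu>])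
  then show False
    using assms by (simp add: integral_hquad prob_space[unfolded space_\<mu>])
qed

lemma algB_step_good:
  assumes "good x i"
  shows "0 < (LINT y|\<mu>. R (A x i) i y)"
    and "algB_step \<phi> \<mu> \<delta> 1 i x = density \<mu> (\<lambda>y. ennreal (R (A x i) i y / (LINT y|\<mu>. R (A x i) i y)))"
proof -
  have inv: "pos_def (B x i)" "Re (trace (matrix_inv (B x i))) \<le> 1"
    using barrier_invariant[OF assms] by auto
  note * = inv(1) refl refl inv(2) \<delta>
  show pos: "0 < (LINT y|\<mu>. R (A x i) i y)"
    by (intro integral_R_pos trace_W_mat_ge[OF *])
  have "trace (matrix_inv (shift_mat (A x i) (ell CARD('n) \<delta> i + \<delta>))) \<noteq> trace (matrix_inv (B x i))"
    using trace_diff_pos[OF *] by auto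
  then show "algB_step \<phi> \<mu> \<delta> 1 i x = density \<mu> (\<lambda>y. ennreal (R (A x i) i y / (LINT y|\<mu>. R (A x i) i y)))"
    using pos pos_def_invertible[OF inv(1)] pos_def_invertible[OF pos_def_shift_next[OF *]]
    by (simp add: algB_step_def Let_def)
qed

lemma AE_algB_step:
  assumes "good x i"
  shows "AE y in algB_step \<phi> \<mu> \<delta> 1 i x. 0 < R (A x i) i y"
  unfolding algB_step_good(2)[OF assms]
proof (subst AE_density)
  show "AE y in \<mu>. 0 < ennreal (R (A x i) i y / (LINT y|\<mu>. R (A x i) i y)) \<longrightarrow> 0 < R (A x i) i y"
    using algB_step_good(1)[OF assms] by (auto simp: zero_less_divide_iff)
qed measurable

lemma good_upd: "good (x(Suc m := y)) (Suc m) \<longleftrightarrow> good x m \<and> 0 < R (A x m) m y"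
proof -
  have A: "A (x(Suc m := y)) i = A x i" if "i \<le> m" for i
    using that by (intro A_mat_cong) auto
  have "good (x(Suc m := y)) (Suc m)
    \<longleftrightarrow> good (x(Suc m := y)) m \<and> 0 < R (A (x(Suc m := y)) m) m ((x(Suc m := y)) (Suc m))"
    by (auto simp: good_def less_Suc_eq)
  also have "good (x(Suc m := y)) m \<longleftrightarrow> good x m"
    by (auto simp: good_def A)
  finally show ?thesis by (simp only: A[OF order_refl] fun_upd_same)
qed

lemma measurable_good: "Measurable.pred (PM m) (\<lambda>x. good x m)"
proof -
  have "Measurable.pred (PM m) (\<lambda>x. 0 < R (A x i) i (x (Suc i)))" if "i \<in> {..<m}" for i
  proof -
    have [measurable]: "(\<lambda>x. A x i) \<in> borel_measurable (PM m)" "(\<lambda>x. x (Suc i)) \<in> measurable (PM m) borel"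
      using that by (intro measurable_A measurable_point; simp)+
    show ?thesis by measurable
  qed
  then have "Measurable.pred (PM m) (\<lambda>x. \<forall>i\<in>{..<m}. 0 < R (A x i) i (x (Suc i)))"
    by (intro pred_intros_finite) auto
  then show ?thesis
    unfolding good_def Ball_def lessThan_iff .
qed

text \<open>The three claims need a joint induction: the kernel of the next step is known to have
  mass 1 only on good histories, so almost sure goodness is what keeps the law a probability
  measure, and measurability of the kernel refers to the product
  \<open>\<sigma>\<close>-algebra.\<close>

lemma algB_good:
  "sets (algB \<phi> \<mu> \<delta> 1 m) = sets (PM m) \<and> prob_space (algB \<phi> \<mu> \<delta> 1 m)
    \<and> (AE x in algB \<phi> \<mu> \<delta> 1 m. good x m)"
proof (induction m)
  case 0
  have "(\<lambda>i. undefined) \<in> space (PM 0)"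
    by (simp add: space_PiM)
  then show ?case
    by (auto simp: good_def intro: prob_space_return)
next
  case (Suc m)
  let ?P = "algB \<phi> \<mu> \<delta> 1 m"
  define N where "N = (\<lambda>x. distr (algB_step \<phi> \<mu> \<delta> 1 m x) (PM (Suc m)) (\<lambda>y. x(Suc m := y)))"
  interpret P: prob_space ?P using Suc by simp
  have sets_P [measurable_cong]: "sets ?P = sets (PM m)" using Suc by simp
  have space_P: "space ?P = space (PM m)" using sets_P by (rule sets_eq_imp_space_eq)
  have AE_P: "AE x in ?P. good x m" using Suc by simp
  have eq: "algB \<phi> \<mu> \<delta> 1 (Suc m) = ?P \<bind> N"
    by (simp add: N_def)
  have upd: "(\<lambda>(x, y). x(Suc m := y)) \<in> measurable (PM m \<Otimes>\<^sub>M \<mu>) (PM (Suc m))"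
    unfolding split_beta'
    by (rule measurable_fun_upd[where J = "{1..m}"]) auto
  then have "N \<in> measurable (PM m) (subprob_algebra (PM (Suc m)))"
    unfolding N_def by (rule measurable_distr2) (rule measurable_algB_step)
  then have N: "N \<in> measurable ?P (subprob_algebra (PM (Suc m)))"
    by (simp only: measurable_cong_sets[OF sets_P refl])
  have upd1: "(\<lambda>y. x(Suc m := y)) \<in> measurable (algB_step \<phi> \<mu> \<delta> 1 m x) (PM (Suc m))"
    if "good x m" "x \<in> space ?P" for x
    using measurable_compose[OF measurable_Pair1' upd, of x] that
    by (simp add: space_P algB_step_good(2))
  have "AE x in ?P. prob_space (N x)"
    using AE_P AE_space
  proof eventually_elim
    case (elim x)
    then show ?case
      unfolding N_def
      using prob_space_R[OF algB_step_good(1)[OF elim(1)]] upd1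
      by (intro prob_space.prob_space_distr) (simp_all add: algB_step_good(2))
  qed
  then have "prob_space (?P \<bind> N)"
    by (rule P.prob_space_bind[OF _ N])
  moreover have "sets (?P \<bind> N) = sets (PM (Suc m))"
    by (rule sets_bind_measurable[OF N P.not_empty])
  moreover have "AE x in ?P \<bind> N. good x (Suc m)"
    unfolding AE_bind[OF N measurable_good]
    using AE_P AE_space
  proof eventually_elim
    case (elim x)
    have "AE y in algB_step \<phi> \<mu> \<delta> 1 m x. good (x(Suc m := y)) (Suc m)"
      using AE_algB_step[OF elim(1)] elim(1) by (simp add: good_upd)
    then show ?case
      unfolding N_def
      by (subst AE_distr_iff[OF upd1[OF elim]]) (use measurable_good in \<open>auto simp: pred_def\<close>)
  qed
  ultimately show ?case
    unfolding eq by blast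
qed

end

section \<open>Interpolation at the selected points\<close>

lemma linf_norm_le_iff:
  "0 \<le> e \<Longrightarrow> linf_norm h \<le> ennreal e \<longleftrightarrow> (\<forall>y. cmod (h y) \<le> e)"
  by (simp add: linf_norm_def SUP_le_iff)

section \<open>Coefficient vectors and best uniform approximation\<close>

definition comb :: "('n::finite \<Rightarrow> 'a \<Rightarrow> complex) \<Rightarrow> complex ^ 'n \<Rightarrow> 'a \<Rightarrow> complex"
  where "comb \<phi> c y = (\<Sum>i\<in>UNIV. c $ i * \<phi> i y)"

lemma comb_diff: "comb \<phi> (c - d) y = comb \<phi> c y - comb \<phi> d y"
  by (simp add: comb_def sum_subtractf algebra_simps)

lemma comb_zero: "comb \<phi> 0 y = 0"
  by (simp add: comb_def)

lemma is_basis_comb: "is_basis \<phi> V \<Longrightarrow> v \<in> V \<longleftrightarrow> (\<exists>c. v = comb \<phi> c)"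
  unfolding comb_def fun_eq_iff using is_basis_combination[of \<phi> V v] by (simp add: fun_eq_iff)

lemma cmod_comb_le: "cmod (comb \<phi> c y) \<le> norm c * norm (vec_at \<phi> y)"
proof -
  have "cmod (comb \<phi> c y) \<le> (\<Sum>i\<in>UNIV. \<bar>cmod (c $ i)\<bar> * \<bar>cmod (\<phi> i y)\<bar>)"
    unfolding comb_def by (intro order_trans[OF norm_sum]) (simp add: norm_mult)
  also have "\<dots> \<le> norm c * norm (vec_at \<phi> y)"
    unfolding norm_vec_def vec_at_def
    using L2_set_mult_ineq[of "\<lambda>i. cmod (c $ i)" "\<lambda>i. cmod (\<phi> i y)" UNIV] by simp
  finally show ?thesis .
qed

text \<open>Makes the minimum in the theorem an attained one. The uniform error is Lipschitz in the
  coefficients by the bound with \<open>L\<close> and coercive by the bound with \<open>C\<close>,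
  so minimising over a closed ball is enough.\<close>

lemma best_approximation_exists:
  fixes \<phi> :: "'n::finite \<Rightarrow> 'a \<Rightarrow> complex"
  assumes "0 \<le> L" and L: "\<And>c y. cmod (comb \<phi> c y) \<le> L * norm c"
    and C: "\<And>c e. (\<And>y. cmod (comb \<phi> c y) \<le> e) \<Longrightarrow> norm c \<le> C * e"
  shows "\<exists>c. \<forall>d. linf_norm (\<lambda>t. f t - comb \<phi> c t) \<le> linf_norm (\<lambda>t. f t - comb \<phi> d t)"
\<comment> \<open>If \<open>f\<close> is at infinite distance from every combination, all
  coefficient vectors are minimal. Otherwise some \<open>c0\<close> has a finite error
  \<open>e0\<close>.\<close>
proof (cases "\<forall>d. linf_norm (\<lambda>t. f t - comb \<phi> d t) = \<top>")
  case True
  then show ?thesis by simp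
next
  case False
  then obtain c0 e0 where "0 \<le> e0" "linf_norm (\<lambda>t. f t - comb \<phi> c0 t) = ennreal e0"
    by (metis ennreal_cases)
  then have e0: "0 \<le> e0" "\<And>y. cmod (f y - comb \<phi> c0 y) \<le> e0"
    using linf_norm_le_iff[of e0 "\<lambda>t. f t - comb \<phi> c0 t"] by auto
  define g where "g c = (SUP y. cmod (f y - comb \<phi> c y))" for c
  have step: "cmod (f y - comb \<phi> c y) \<le> cmod (f y - comb \<phi> d y) + L * norm (c - d)" for c d y
  proof -
    have "f y - comb \<phi> c y = (f y - comb \<phi> d y) - comb \<phi> (c - d) y"
      by (simp add: comb_diff)
    then show ?thesis
      by (metis L add_left_mono norm_triangle_ineq4 order_trans)
  qed
  have le_g: "cmod (f y - comb \<phi> c y) \<le> g c" for c y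
    unfolding g_def
  proof (intro cSUP_upper bdd_aboveI2)
    show "cmod (f y - comb \<phi> c y) \<le> e0 + L * norm (c - c0)" for y
      using step[of y c c0] e0(2)[of y] by linarith
  qed simp
  have g_le: "g c \<le> e" if "\<And>y. cmod (f y - comb \<phi> c y) \<le> e" for c e
    unfolding g_def by (intro cSUP_least that) simp
  have lip: "g c \<le> g d + L * norm (c - d)" for c d
    by (intro g_le order_trans[OF step[of _ c d]] add_right_mono le_g)
  have "dist (g c) (g d) \<le> L * dist c d" for c d
    using lip[of c d] lip[of d c] by (simp add: dist_real_def dist_norm norm_minus_commute abs_le_iff)
  then have "L-lipschitz_on UNIV g"
    using \<open>0 \<le> L\<close> by (intro lipschitz_onI)
  \<comment> \<open>The radius: if \<open>d\<close> has error at most \<open>e0\<close>, then the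
    combination with coefficients c0 - d is bounded by 2 e0, and the assumption on \<open>C\<close>
    puts \<open>d\<close> into this ball.\<close>
  then have "continuous_on (cball c0 (C * (2 * e0))) g"
    by (intro continuous_on_subset[OF lipschitz_on_continuous_on]) auto
  moreover have "0 \<le> C * (2 * e0)"
    using C[of 0 "2 * e0"] e0(1) by (simp add: comb_zero)
  then have c0: "c0 \<in> cball c0 (C * (2 * e0))"
    by simp
  ultimately obtain c where c: "c \<in> cball c0 (C * (2 * e0))"
    "\<And>d. d \<in> cball c0 (C * (2 * e0)) \<Longrightarrow> g c \<le> g d"
    using continuous_attains_inf[OF compact_cball[of c0 "C * (2 * e0)"], of g] by blast
  have gc: "g c \<le> g d" for d
  proof (cases "d \<in> cball c0 (C * (2 * e0))")
    case True
    then show ?thesis by (rule c(2))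
  next
    case False
    have "e0 \<le> g d"
    proof (rule ccontr)
      assume "\<not> e0 \<le> g d"
      then have "cmod (f y - comb \<phi> d y) \<le> e0" for y
        using le_g[of y d] by linarith
      then have "cmod (comb \<phi> (c0 - d) y) \<le> 2 * e0" for y
        using norm_triangle_ineq4[of "f y - comb \<phi> d y" "f y - comb \<phi> c0 y"] e0(2)[of y] le_g[of y d]
        by (simp add: comb_diff algebra_simps) (smt (verit) \<open>\<And>y. cmod (f y - comb \<phi> d y) \<le> e0\<close>)
      then show False
        using C[of "c0 - d" "2 * e0"] False by (simp add: dist_norm)
    qed
    then show ?thesis
      using c(2)[OF c0] g_le[OF e0(2)] by linarith
  qed
  have g0: "0 \<le> g d" for d
    using order_trans[OF norm_ge_zero le_g] .
  show ?thesis
  proof (intro exI[of _ c] allI)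
    fix d
    show "linf_norm (\<lambda>t. f t - comb \<phi> c t) \<le> linf_norm (\<lambda>t. f t - comb \<phi> d t)"
    proof (cases "linf_norm (\<lambda>t. f t - comb \<phi> d t)")
      case (real e)
      then have "g d \<le> e"
        using linf_norm_le_iff[of e "\<lambda>t. f t - comb \<phi> d t"] by (intro g_le) auto
      have "linf_norm (\<lambda>t. f t - comb \<phi> c t) \<le> ennreal (g c)"
        by (intro linf_norm_le_iff[THEN iffD2] g0 allI le_g)
      also have "\<dots> \<le> ennreal e"
        using gc[of d] \<open>g d \<le> e\<close> by (intro ennreal_leI) linarith
      finally show ?thesis
        using real by simp
    qed simp
  qed
qed

section \<open>Sampling inequality and interpolation error\<close>

context point_selection
begin

lemma hquad_A_mat:
  "hquad (A x m) u = (\<Sum>i<m. 1 / R (A x i) i (x (Suc i)) * (cmod (cdot (vec_at \<phi> (x (Suc i))) u))\<^sup>2)"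
  by (induction m) (simp_all add: hquad_simps hquad_outer hquad_cdot[of 0] cdot_def[of _ 0])

lemma sampling_inequality:
  assumes "good x m"
  shows "(1 + ell CARD('n) \<delta> m) * (norm c)\<^sup>2 \<le> \<delta> / (1 - \<delta>) * (\<Sum>i\<in>{1..m}. (cmod (comb \<phi> c (x i)))\<^sup>2)"
proof -
  \<comment> \<open>Conjugated because \<open>cdot\<close> conjugates its first argument: the
    product of \<open>vec_at \<phi> y\<close> with \<open>u\<close> is then the conjugate of
    \<open>comb \<phi> c y\<close>.\<close>
  define u where "u = (\<chi> i. cnj (c $ i))"
  have norm_u: "norm u = norm c"
    by (simp add: u_def norm_vec_def)
  have "cdot (vec_at \<phi> y) u = cnj (comb \<phi> c y)" for y
    by (simp add: cdot_def comb_def vec_at_def u_def mult.commute)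
  then have cdot_u: "cmod (cdot (vec_at \<phi> y) u) = cmod (comb \<phi> c y)" for y
    by simp
  have "(norm u)\<^sup>2 \<le> hquad (B x m) u"
    using barrier_invariant[OF assms] by (intro pos_def_ge_norm) auto
  then have "(1 + ell CARD('n) \<delta> m) * (norm c)\<^sup>2 \<le> hquad (A x m) u"
    by (simp add: hquad_shift_mat norm_u algebra_simps)
  also have "\<dots> \<le> (\<Sum>i<m. \<delta> / (1 - \<delta>) * (cmod (comb \<phi> c (x (Suc i))))\<^sup>2)"
    unfolding hquad_A_mat cdot_u
  proof (intro sum_mono mult_right_mono)
    fix i assume "i \<in> {..<m}"
    then have "\<theta> \<le> R (A x i) i (x (Suc i))"
      using assms by (intro R_ge) (simp add: good_def)
    then have "1 / R (A x i) i (x (Suc i)) \<le> 1 / \<theta>"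
      using \<theta>_pos by (intro frac_le) auto
    then show "1 / R (A x i) i (x (Suc i)) \<le> \<delta> / (1 - \<delta>)"
      by simp
  qed simp
  also have "\<dots> = \<delta> / (1 - \<delta>) * (\<Sum>i\<in>{1..m}. (cmod (comb \<phi> c (x i)))\<^sup>2)"
    unfolding sum_distrib_left by (rule sum.reindex_bij_witness[of _ "\<lambda>i. i - 1" Suc]) auto
  finally show ?thesis .
qed

text \<open>The choice of \<open>\<delta>\<close> gives n (1 - \<delta>) (1 + \<delta>) = 1, which
  turns the two sides of the sampling inequality into \<delta> / (1 + \<delta>) and n \<delta> (1 +
  \<delta>). Their quotient and the n nodal values yield n (1 + \<delta>) e, and \<delta> < 1 rounds
  this to 2 n e.\<close>

lemma norm_coefficients_le:
  assumes "good x CARD('n)" and \<delta>_def: "\<delta> = sqrt (1 - 1 / real CARD('n))"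
    and e: "\<And>i. i \<in> {1..CARD('n)} \<Longrightarrow> cmod (comb \<phi> c (x i)) \<le> e"
  shows "norm c \<le> 2 * real CARD('n) * e"
proof -
  define n where "n = real CARD('n)"
  have n: "n \<ge> 1"
    by (simp add: n_def Suc_leI)
  have e0: "e \<ge> 0"
    using order_trans[OF norm_ge_zero e[of 1]] by (simp add: Suc_leI)
  have "\<delta>\<^sup>2 = 1 - 1 / n"
    using n by (simp add: \<delta>_def n_def)
  then have n\<delta>: "n * ((1 - \<delta>) * (1 + \<delta>)) = 1"
    using n by (simp add: power2_eq_square field_simps)
  have "(1 + ell CARD('n) \<delta> CARD('n)) * (1 + \<delta>) = (1 + \<delta>) - n * ((1 - \<delta>) * (1 + \<delta>))"
    by (simp add: ell_eq n_def algebra_simps)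
  then have l: "1 + ell CARD('n) \<delta> CARD('n) = \<delta> / (1 + \<delta>)"
    unfolding n\<delta> using \<delta> by (simp add: field_simps)
  have s: "\<delta> / (1 - \<delta>) = n * \<delta> * (1 + \<delta>)"
  proof -
    have "\<delta> / (1 - \<delta>) = \<delta> * (n * ((1 - \<delta>) * (1 + \<delta>))) / (1 - \<delta>)"
      unfolding n\<delta> by simp
    then show ?thesis
      using \<delta> by simp
  qed
  have "(\<Sum>i\<in>{1..CARD('n)}. (cmod (comb \<phi> c (x i)))\<^sup>2) \<le> (\<Sum>i\<in>{1..CARD('n)}. e\<^sup>2)"
    by (intro sum_mono power_mono e) auto
  then have "\<delta> / (1 + \<delta>) * (norm c)\<^sup>2 \<le> n * \<delta> * (1 + \<delta>) * (n * e\<^sup>2)"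
    using sampling_inequality[OF assms(1), of c] n \<delta> unfolding l s
    by (elim order_trans) (intro mult_left_mono, auto simp: n_def)
  then have "(1 + \<delta>) / \<delta> * (\<delta> / (1 + \<delta>) * (norm c)\<^sup>2) \<le> (1 + \<delta>) / \<delta> * (n * \<delta> * (1 + \<delta>) * (n * e\<^sup>2))"
    using \<delta> by (intro mult_left_mono) auto
  moreover have "(1 + \<delta>) / \<delta> * (\<delta> / (1 + \<delta>) * (norm c)\<^sup>2) = (norm c)\<^sup>2"
    using \<delta> by simp
  moreover have "(1 + \<delta>) / \<delta> * (n * \<delta> * (1 + \<delta>) * (n * e\<^sup>2)) = (n * (1 + \<delta>) * e)\<^sup>2"
    using \<delta> by (simp add: power2_eq_square)
  ultimately have "(norm c)\<^sup>2 \<le> (n * (1 + \<delta>) * e)\<^sup>2"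
    by simp
  then have "norm c \<le> n * (1 + \<delta>) * e"
    by (rule power2_le_imp_le) (use n \<delta> e0 in simp)
  also have "\<dots> \<le> n * 2 * e"
    using n \<delta> e0 by (intro mult_right_mono mult_left_mono) auto
  finally show ?thesis
    by (simp add: n_def mult_ac)
qed

text \<open>With e = 0 the coefficient bound says that zero values at the nodes force zero
  coefficients. The evaluation matrix is square, so this gives existence as well as
  uniqueness.\<close>

lemma good_unisolvent:
  assumes "good x CARD('n)" "\<delta> = sqrt (1 - 1 / real CARD('n))" "is_basis \<phi> V"
  shows "unisolvent V CARD('n) x"
  unfolding unisolvent_def
proof
  fix y :: "nat \<Rightarrow> complex"
  note bound = norm_coefficients_le[OF assms(1,2)]
  \<comment> \<open>Points are numbered 1 to n, whereas the rows of a matrix are indexed by the type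
    \<open>'n\<close>.\<close>
  obtain b :: "'n \<Rightarrow> nat" where b: "bij_betw b UNIV {1..CARD('n)}"
    using finite_same_card_bij[of "UNIV :: 'n set" "{1..CARD('n)}"] by auto
  then have b_surj: "\<exists>k. i = b k" if "i \<in> {1..CARD('n)}" for i
    using that by (auto simp: bij_betw_def)
  define E :: "complex ^ 'n ^ 'n" where "E = (\<chi> k j. \<phi> j (x (b k)))"
  have E: "(E *v c) $ k = comb \<phi> c (x (b k))" for c k
    by (simp add: E_def matrix_vector_mult_def comb_def mult.commute)
  have "c = 0" if "E *v c = 0" for c
  proof -
    have "norm c \<le> 2 * real CARD('n) * 0"
      using b_surj by (intro bound) (metis E that norm_zero order_refl zero_index)
    then show ?thesis by simp
  qed
  then have inv: "invertible E"
    using invertible_left_inverse matrix_left_invertible_ker by blast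
  define c where "c = matrix_inv E *v (\<chi> k. y (b k))"
  have "E *v c = (\<chi> k. y (b k))"
    by (simp add: c_def matrix_vector_mul_assoc matrix_inv_mult[OF inv])
  then have "comb \<phi> c (x (b k)) = y (b k)" for k
    by (metis E vec_lambda_beta)
  then have c: "\<And>i. i \<in> {1..CARD('n)} \<Longrightarrow> comb \<phi> c (x i) = y i"
    using b_surj by metis
  show "\<exists>!v. v \<in> V \<and> (\<forall>i\<in>{1..CARD('n)}. v (x i) = y i)"
  proof (intro ex1I[of _ "comb \<phi> c"] conjI ballI c)
    show "comb \<phi> c \<in> V"
      using is_basis_comb[OF assms(3)] by blast
    fix v assume v: "v \<in> V \<and> (\<forall>i\<in>{1..CARD('n)}. v (x i) = y i)"
    then obtain d where d: "v = comb \<phi> d"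
      using is_basis_comb[OF assms(3)] by blast
    have "norm (d - c) \<le> 2 * real CARD('n) * 0"
      using v d c by (intro bound) (simp add: comb_diff)
    then show "v = comb \<phi> c"
      using d by simp
  qed
qed

text \<open>At the nodes the interpolant agrees with \<open>f\<close>, so its difference from the
  best approximant is at most the best error \<open>e\<close> there. The coefficient bound and
  |\<phi>(y)| <= sqrt n extend this to 2 n sqrt n e everywhere; the triangle inequality adds the
  final \<open>e\<close>.\<close>

lemma interpolation_bound:
  assumes good: "good x CARD('n)" and \<delta>_def: "\<delta> = sqrt (1 - 1 / real CARD('n))" and basis: "is_basis \<phi> V"
    and vec: "\<And>y. (norm (vec_at \<phi> y))\<^sup>2 \<le> real CARD('n)"
  shows "\<exists>v. is_arg_min (\<lambda>v. linf_norm (\<lambda>t. f t - v t)) (\<lambda>v. v \<in> V) v \<and>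
    linf_norm (\<lambda>t. f t - interpolant V CARD('n) x f t)
      \<le> ennreal (1 + 2 * real CARD('n) * sqrt (real CARD('n))) * linf_norm (\<lambda>t. f t - v t)"
proof -
  let ?n = "real CARD('n)"
  note bound = norm_coefficients_le[OF good \<delta>_def]
  have vec': "norm (vec_at \<phi> y) \<le> sqrt ?n" for y
    using vec real_le_rsqrt by blast
  have comb_le: "cmod (comb \<phi> c y) \<le> sqrt ?n * norm c" for c y
    using order_trans[OF cmod_comb_le mult_left_mono[OF vec' norm_ge_zero]] by (simp add: mult.commute)
  \<comment> \<open>Coercivity with constant 2 n comes from the nodes: a bound everywhere is in
    particular a bound at the selected points.\<close>
  obtain c where c: "\<And>d. linf_norm (\<lambda>t. f t - comb \<phi> c t) \<le> linf_norm (\<lambda>t. f t - comb \<phi> d t)"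
    using best_approximation_exists[of "sqrt ?n" \<phi> "2 * ?n" f] comb_le bound by auto
  have "is_arg_min (\<lambda>v. linf_norm (\<lambda>t. f t - v t)) (\<lambda>v. v \<in> V) (comb \<phi> c)"
    unfolding is_arg_min_def using c is_basis_comb[OF basis] by (auto simp: not_less)
  moreover have "linf_norm (\<lambda>t. f t - interpolant V CARD('n) x f t)
      \<le> ennreal (1 + 2 * ?n * sqrt ?n) * linf_norm (\<lambda>t. f t - comb \<phi> c t)"
  proof (cases "linf_norm (\<lambda>t. f t - comb \<phi> c t)")
    case (real e)
    then have e: "cmod (f y - comb \<phi> c y) \<le> e" for y
      using linf_norm_le_iff[of e "\<lambda>t. f t - comb \<phi> c t"] by auto
    have "\<exists>!v. v \<in> V \<and> (\<forall>i\<in>{1..CARD('n)}. v (x i) = f (x i))"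
      using good_unisolvent[OF good \<delta>_def basis] unfolding unisolvent_def by (rule spec)
    from theI'[OF this] have "interpolant V CARD('n) x f \<in> V
      \<and> (\<forall>i\<in>{1..CARD('n)}. interpolant V CARD('n) x f (x i) = f (x i))"
      unfolding interpolant_def .
    then obtain d where d: "interpolant V CARD('n) x f = comb \<phi> d"
      and eq: "\<And>i. i \<in> {1..CARD('n)} \<Longrightarrow> comb \<phi> d (x i) = f (x i)"
      using is_basis_comb[OF basis] by auto
    have "norm (d - c) \<le> 2 * ?n * e"
      by (rule bound) (simp add: comb_diff eq e)
    have "cmod (f y - comb \<phi> d y) \<le> (1 + 2 * ?n * sqrt ?n) * e" for y
    proof -
      have "cmod (comb \<phi> (d - c) y) \<le> sqrt ?n * (2 * ?n * e)"
        using \<open>norm (d - c) \<le> 2 * ?n * e\<close>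
        by (intro order_trans[OF comb_le] mult_left_mono) auto
      moreover have eq: "f y - comb \<phi> d y = (f y - comb \<phi> c y) - comb \<phi> (d - c) y"
        by (simp add: comb_diff)
      ultimately have "cmod (f y - comb \<phi> d y) \<le> e + sqrt ?n * (2 * ?n * e)"
        using norm_triangle_ineq4[of "f y - comb \<phi> c y" "comb \<phi> (d - c) y"] e[of y]
        unfolding eq by linarith
      then show ?thesis
        by (simp add: algebra_simps)
    qed
    then have "linf_norm (\<lambda>t. f t - comb \<phi> d t) \<le> ennreal ((1 + 2 * ?n * sqrt ?n) * e)"
      using real by (subst linf_norm_le_iff) auto
    then show ?thesis
      using real by (simp add: d ennreal_mult)
  next
    case top
    have "0 < ennreal (1 + 2 * ?n * sqrt ?n)"
      by (simp add: add_pos_nonneg)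
    then show ?thesis
      by (simp add: top ennreal_mult_top)
  qed
  ultimately show ?thesis by blast
qed

end

text \<open>The quantifier over \<open>f\<close> stands inside the almost sure statement: one null
  set serves all \<open>f\<close>, since everything that follows from \<open>good\<close> is
  deterministic. The existential over \<open>v\<close> records that the minimum is attained.\<close>

theorem corollary1p4:
  fixes V :: "('a::topological_space \<Rightarrow> complex) set"
    and n :: nat
    and \<mu> :: "'a measure"
    and \<psi> \<phi> :: "'n::finite \<Rightarrow> 'a \<Rightarrow> complex"
  assumes "compact (UNIV :: 'a set)"
    and "n \<ge> 2" and "CARD('n) = n"
    and "cfun.subspace V" and "cfun.dim V = n"
    and "\<And>v. v \<in> V \<Longrightarrow> bounded (range v) \<and> v \<in> borel_measurable borel"
    and "is_basis \<psi> V" and "optimal_measure \<psi> \<mu>"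
    and "is_basis \<phi> V" and "orthonormal_on \<mu> \<phi>"
  shows "prob_space (algB \<phi> \<mu> (sqrt (1 - 1 / n)) 1 n) \<and>
    (AE x in algB \<phi> \<mu> (sqrt (1 - 1 / n)) 1 n.
      unisolvent V n x \<and>
      (\<forall>f :: 'a \<Rightarrow> complex.
        \<exists>v. is_arg_min (\<lambda>v. linf_norm (\<lambda>t. f t - v t)) (\<lambda>v. v \<in> V) v \<and>
            linf_norm (\<lambda>t. f t - interpolant V n x f t)
              \<le> ennreal (1 + 2 * n * sqrt n) * linf_norm (\<lambda>t. f t - v t)))"
proof -
  have family: "\<exists>K. bounded_family \<xi> K" if "is_basis \<xi> V" for \<xi> :: "'n \<Rightarrow> 'a \<Rightarrow> complex"
  proof -
    have V: "\<xi> i \<in> V" for i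
      using that by (auto simp: is_basis_def intro: cfun.span_base)
    have "bounded (\<Union>i\<in>UNIV. range (\<xi> i))"
      using assms(6)[OF V] by (intro bounded_UN) auto
    then obtain K where "\<forall>z\<in>(\<Union>i\<in>UNIV. range (\<xi> i)). cmod z \<le> K"
      unfolding bounded_iff by blast
    then have "bounded_family \<xi> K"
      using assms(6)[OF V] by unfold_locales auto
    then show ?thesis ..
  qed
  obtain K K' where K: "bounded_family \<psi> K" "bounded_family \<phi> K'"
    using family[OF assms(7)] family[OF assms(9)] by blast
  define \<delta> where "\<delta> = sqrt (1 - 1 / n)"
  \<comment> \<open>Here n >= 2 enters: for n = 1 the barrier would not move.\<close>
  have "0 < \<delta>" "\<delta> < 1"
    using assms(2) by (simp_all add: \<delta>_def real_sqrt_less_iff)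
  moreover have "\<mu> \<in> space (prob_algebra borel)"
    using assms(8) by (auto simp: optimal_measure_def is_arg_min_def)
  ultimately interpret point_selection \<phi> K' \<mu> \<delta>
    using K(2) assms(10) by (intro point_selection.intro) (simp_all add: point_selection_axioms_def)
  have n: "n = CARD('n)"
    using assms(3) by simp
  have \<delta>': "\<delta> = sqrt (1 - 1 / real CARD('n))"
    by (simp add: \<delta>_def n)
  have vec: "(norm (vec_at \<phi> y))\<^sup>2 \<le> real CARD('n)" for y
    by (rule orthonormal_norm_le[OF K assms(7,9,8,10)])
  have prob: "prob_space (algB \<phi> \<mu> \<delta> 1 CARD('n))"
    and "AE x in algB \<phi> \<mu> \<delta> 1 CARD('n). good x CARD('n)"
    using algB_good by blast+
  from this(2) have "AE x in algB \<phi> \<mu> \<delta> 1 n. unisolvent V n x \<and>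
    (\<forall>f. \<exists>v. is_arg_min (\<lambda>v. linf_norm (\<lambda>t. f t - v t)) (\<lambda>v. v \<in> V) v \<and>
      linf_norm (\<lambda>t. f t - interpolant V n x f t)
        \<le> ennreal (1 + 2 * n * sqrt n) * linf_norm (\<lambda>t. f t - v t))"
    unfolding n
  proof eventually_elim
    case (elim x)
    then show ?case
      using good_unisolvent[OF elim \<delta>' assms(9)] interpolation_bound[OF elim \<delta>' assms(9) vec]
      by simp
  qed
  with prob show ?thesis
    unfolding \<delta>_def n by simp
qed

end
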